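(* Let $X$ be a curve of genus $g$ over a finite field, $P$ a rational point and $C$ a divisor class. Then $\gamma_P(C)\geq\max\{0,\deg C\}$. Moreover $\gamma_P(C)=0\iff -C\in\Gamma_P\iff\Gamma_P(C)=\Gamma_P$, and $\gamma_P(C)=\deg C\iff C\in\Gamma_P\iff\Gamma_P(-C)=\Gamma_P$. The inequality $\gamma_P(C)\geq\max\{0,\deg C\}$ is strict if and only if $C\notin\Gamma_P$ and $-C\notin\Gamma_P$, and this can happen only if $|\deg C|<2g$.
   Context: $L(E)=\{f:(f)+E\ge0\}\cup\{0\}$; $\Gamma_P$ is the set of divisor classes $A$ with $L(A)\neq L(A-P)$; $\Gamma_P(C)=\{A\in\Gamma_P : A-C\in\Gamma_P\}$; $\gamma_P(C)=\min\{\deg A : A\in\Gamma_P(C)\}$. *)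

theory Defs
  imports "HOL-Computational_Algebra.Polynomial" "HOL-Library.Poly_Mapping"
begin

text \<open>
  A curve (smooth, projective, geometrically irreducible) over the field \<open>'k\<close> is represented
  by its function field \<open>'a\<close> together with the inclusion \<open>\<iota>\<close> of the constants, and its closed
  points by the places of that function field.
\<close>

definition transcendental_over :: "('k::field \<Rightarrow> 'a::field) \<Rightarrow> 'a \<Rightarrow> bool" where
  "transcendental_over \<iota> x \<longleftrightarrow> (\<forall>p. p \<noteq> 0 \<longrightarrow> poly (map_poly \<iota> p) x \<noteq> 0)"

definition simple_extension :: "('k::field \<Rightarrow> 'a::field) \<Rightarrow> 'a \<Rightarrow> 'a set" where
  "simple_extension \<iota> x =
     {poly (map_poly \<iota> p) x / poly (map_poly \<iota> q) x | p q. poly (map_poly \<iota> q) x \<noteq> 0}"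

locale function_field =
  fixes \<iota> :: "'k::field \<Rightarrow> 'a::field"
  assumes hom_one: "\<iota> 1 = 1"
    and hom_add: "\<iota> (a + b) = \<iota> a + \<iota> b"
    and hom_mult: "\<iota> (a * b) = \<iota> a * \<iota> b"
    and finite_over_rational:
      "\<exists>x. transcendental_over \<iota> x \<and>
         (\<exists>B. finite B \<and>
            (\<forall>y. \<exists>c. (\<forall>b\<in>B. c b \<in> simple_extension \<iota> x) \<and> y = (\<Sum>b\<in>B. c b * b)))"
    and exact_constants: "\<not> transcendental_over \<iota> y \<Longrightarrow> y \<in> range \<iota>"

text \<open>
  A place is identified with its normalized discrete valuation, trivial on the constants.
  The value \<open>v 0\<close>, mathematically \<open>\<infinity>\<close>, is the dummy \<open>0\<close>, so that distinct functions are
  distinct places; every use of \<open>v x\<close> below treats \<open>x = 0\<close> separately.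
\<close>

definition places :: "('k::field \<Rightarrow> 'a::field) \<Rightarrow> ('a \<Rightarrow> int) set" where
  "places \<iota> = {v. v 0 = 0 \<and>
     (\<forall>x y. x \<noteq> 0 \<and> y \<noteq> 0 \<longrightarrow> v (x * y) = v x + v y) \<and>
     (\<forall>x y. x \<noteq> 0 \<and> y \<noteq> 0 \<and> x + y \<noteq> 0 \<longrightarrow> min (v x) (v y) \<le> v (x + y)) \<and>
     (\<forall>c. c \<noteq> 0 \<longrightarrow> v (\<iota> c) = 0) \<and>
     (\<exists>t. t \<noteq> 0 \<and> v t = 1)}"

definition valuation_ring :: "('a::field \<Rightarrow> int) \<Rightarrow> 'a set" where
  "valuation_ring v = {x. x = 0 \<or> 0 \<le> v x}"

definition maximal_ideal :: "('a::field \<Rightarrow> int) \<Rightarrow> 'a set" where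
  "maximal_ideal v = {x. x = 0 \<or> 0 < v x}"

text \<open>\<open>B\<close> is a set of lifts of a \<open>'k\<close>-basis of the residue field
  \<open>valuation_ring v / maximal_ideal v\<close>.\<close>

definition residue_basis :: "('k::field \<Rightarrow> 'a::field) \<Rightarrow> ('a \<Rightarrow> int) \<Rightarrow> 'a set \<Rightarrow> bool" where
  "residue_basis \<iota> v B \<longleftrightarrow> finite B \<and> B \<subseteq> valuation_ring v \<and>
     (\<forall>x\<in>valuation_ring v. \<exists>!c. (\<forall>b. b \<notin> B \<longrightarrow> c b = 0) \<and>
        x - (\<Sum>b\<in>B. \<iota> (c b) * b) \<in> maximal_ideal v)"

definition place_degree :: "('k::field \<Rightarrow> 'a::field) \<Rightarrow> ('a \<Rightarrow> int) \<Rightarrow> nat" where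
  "place_degree \<iota> v = (THE n. \<exists>B. residue_basis \<iota> v B \<and> card B = n)"

definition rational_place :: "('k::field \<Rightarrow> 'a::field) \<Rightarrow> ('a \<Rightarrow> int) \<Rightarrow> bool" where
  "rational_place \<iota> v \<longleftrightarrow> v \<in> places \<iota> \<and> place_degree \<iota> v = 1"

type_synonym 'a divisor = "('a \<Rightarrow> int) \<Rightarrow>\<^sub>0 int"

definition divisors :: "('k::field \<Rightarrow> 'a::field) \<Rightarrow> 'a divisor set" where
  "divisors \<iota> = {D. Poly_Mapping.keys D \<subseteq> places \<iota>}"

definition div_degree :: "('k::field \<Rightarrow> 'a::field) \<Rightarrow> 'a divisor \<Rightarrow> int" where
  "div_degree \<iota> D =
     (\<Sum>v\<in>Poly_Mapping.keys D. Poly_Mapping.lookup D v * int (place_degree \<iota> v))"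

definition is_divisor_of :: "('k::field \<Rightarrow> 'a::field) \<Rightarrow> 'a \<Rightarrow> 'a divisor \<Rightarrow> bool" where
  "is_divisor_of \<iota> f D \<longleftrightarrow>
     f \<noteq> 0 \<and> D \<in> divisors \<iota> \<and> (\<forall>v\<in>places \<iota>. Poly_Mapping.lookup D v = v f)"

definition LL :: "('k::field \<Rightarrow> 'a::field) \<Rightarrow> 'a divisor \<Rightarrow> 'a set" where
  "LL \<iota> E = {f. f \<noteq> 0 \<and> (\<forall>v\<in>places \<iota>. v f + Poly_Mapping.lookup E v \<ge> 0)} \<union> {0}"

definition ell :: "('k::field \<Rightarrow> 'a::field) \<Rightarrow> 'a divisor \<Rightarrow> nat" where
  "ell \<iota> E = vector_space.dim (\<lambda>c x. \<iota> c * x) (LL \<iota> E)"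

text \<open>The genus as the maximum of \<open>deg D - \<ell>(D) + 1\<close> over all divisors.\<close>

definition genus :: "('k::field \<Rightarrow> 'a::field) \<Rightarrow> int" where
  "genus \<iota> = (GREATEST n. \<exists>D\<in>divisors \<iota>. n = div_degree \<iota> D - int (ell \<iota> D) + 1)"

definition lin_equiv :: "('k::field \<Rightarrow> 'a::field) \<Rightarrow> ('a divisor \<times> 'a divisor) set" where
  "lin_equiv \<iota> =
     {(D, E). D \<in> divisors \<iota> \<and> E \<in> divisors \<iota> \<and> (\<exists>f. is_divisor_of \<iota> f (D - E))}"

definition divisor_classes :: "('k::field \<Rightarrow> 'a::field) \<Rightarrow> 'a divisor set set" where
  "divisor_classes \<iota> = divisors \<iota> // lin_equiv \<iota>"

text \<open>Classes are cosets of the group of principal divisors, so the group operations on classes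
  are the elementwise ones.\<close>

definition class_diff :: "'a divisor set \<Rightarrow> 'a divisor set \<Rightarrow> 'a divisor set" where
  "class_diff A C = {D - E | D E. D \<in> A \<and> E \<in> C}"

definition class_neg :: "'a divisor set \<Rightarrow> 'a divisor set" where
  "class_neg C = uminus ` C"

text \<open>The common degree of the divisors in a class.\<close>

definition class_degree :: "('k::field \<Rightarrow> 'a::field) \<Rightarrow> 'a divisor set \<Rightarrow> int" where
  "class_degree \<iota> A = (THE d. \<forall>D\<in>A. div_degree \<iota> D = d)"

text \<open>Multiplication by a function with divisor \<open>D - E\<close> maps \<open>LL \<iota> D\<close> onto \<open>LL \<iota> E\<close>, so the
  condition defining \<open>Gamma\<close> does not depend on the representative.\<close>

definition Gamma :: "('k::field \<Rightarrow> 'a::field) \<Rightarrow> ('a \<Rightarrow> int) \<Rightarrow> 'a divisor set set" where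
  "Gamma \<iota> P =
     {A \<in> divisor_classes \<iota>. \<exists>D\<in>A. LL \<iota> D \<noteq> LL \<iota> (D - Poly_Mapping.single P 1)}"

definition Gamma_at ::
    "('k::field \<Rightarrow> 'a::field) \<Rightarrow> ('a \<Rightarrow> int) \<Rightarrow> 'a divisor set \<Rightarrow> 'a divisor set set" where
  "Gamma_at \<iota> P C = {A \<in> Gamma \<iota> P. class_diff A C \<in> Gamma \<iota> P}"

definition gamma :: "('k::field \<Rightarrow> 'a::field) \<Rightarrow> ('a \<Rightarrow> int) \<Rightarrow> 'a divisor set \<Rightarrow> int" where
  "gamma \<iota> P C = (LEAST d. d \<in> class_degree \<iota> ` Gamma_at \<iota> P C)"

end

theory Submission
  imports Defs "HOL-Library.FuncSet" "HOL-Library.Cardinality"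
begin

text \<open>
  Everything except the last claim and \<open>\<Gamma>\<^sub>P(C) \<noteq> \<emptyset>\<close> is formal once principal divisors have degree \<open>0\<close>:
  \<open>\<Gamma>\<^sub>P\<close> is closed under addition and contains \<open>0\<close>, its classes have degree \<open>\<ge> 0\<close>, and \<open>0\<close> is the only
  one of degree \<open>0\<close>. Both exceptions follow from \<open>C \<in> \<Gamma>\<^sub>P\<close> for \<open>deg C \<ge> 2g\<close>. This needs no duality,
  only Riemann's inequality \<open>\<ell>(D) \<ge> deg D + 1 - g\<close> and gap counting at \<open>P\<close>.

  As the constant field is finite with \<open>q\<close> elements, dimensions are read off cardinalities. A finite
  subspace \<open>T\<close> is \<^emph>\<open>free over\<close> \<open>y\<close> if all sums \<open>\<Sum> y\<^sup>k t\<^sub>k\<close> with \<open>t\<^sub>k \<in> T\<close> are distinct. Counting these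
  sums bounds \<open>|T|\<close> in terms of \<open>y\<close> alone. This bound makes valuation rings discrete, residue
  fields finite and the zeros of \<open>y\<close> finite in number. By weak approximation some free \<open>T\<close> has
  \<open>q\<^sup>d\<close> elements, \<open>d\<close> being the degree of the zeros of \<open>y\<close>; counting in \<open>L(C + r(y)\<^sub>\<infinity>)\<close> shows that none
  has more than \<open>q\<^sup>e\<close>, \<open>e\<close> being the degree of the poles. Since \<open>y\<close> and \<open>1/y\<close> have the same free
  subspaces, \<open>d = e\<close>, and the same count gives Riemann's inequality.
\<close>

section \<open>Counting lemmas and free subspaces\<close>

text \<open>The degree of the field over the rational functions in \<open>y\<close> is never
  introduced; a growth rate replaces it. With \<open>N\<close> powers of \<open>y\<close> a free
  \<open>T\<close> gives exactly \<open>card T ^ N\<close> sums, while the finite set that contains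
  them has at most \<open>CARD('k) ^ (M * N + e)\<close> elements. The error \<open>e\<close> may
  depend on \<open>T\<close>, the slope \<open>M\<close> does not, and letting \<open>N\<close> grow
  discards the error. This comparison is made twice: first with polynomial combinations, where the
  slope is crude, then with the spaces L(C + rE), where it is the exact pole degree.

  The obstacle is circularity: at the start neither residue fields nor L(D) are known to be finite,
  and \<open>place_degree\<close> and \<open>genus\<close> are descriptions that might denote
  nothing. Hence the crude bound is proved from the field alone, before any place appears. Under it
  one can choose subspaces of largest cardinality, and these supply what a theory of extensions of
  valuations would otherwise give.\<close>

lemma le_power_if_powers_le:
  fixes a q M e :: nat
  assumes "\<And>N. a ^ N \<le> q ^ (M * N + e)" and "q > 0"
  shows "a \<le> q ^ M"
proof (rule ccontr)
  assume "\<not> a \<le> q ^ M"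
  then have "real a / real (q ^ M) > 1"
    using \<open>q > 0\<close> by (simp add: field_simps flip: of_nat_power)
  then obtain N where "real (q ^ e) < (real a / real (q ^ M)) ^ N"
    using real_arch_pow by blast
  then have "real (q ^ e) * real (q ^ M) ^ N < real a ^ N"
    using \<open>q > 0\<close> by (simp add: field_simps)
  then have "real (q ^ (M * N + e)) < real (a ^ N)"
    by (simp add: power_add power_mult mult.commute)
  then show False
    using assms(1)[of N] by linarith
qed

text \<open>An element is determined by its label and by its difference from a chosen element with
  the same label. Here the label will be a leading coefficient at a place.\<close>

lemma card_le_card_fibres:
  fixes U V :: "'a::ab_group_add set"
  assumes fin: "finite V" "finite T"
    and T: "\<And>f. f \<in> U \<Longrightarrow> r f \<in> T"
    and diff: "\<And>f g. \<lbrakk>f \<in> U; g \<in> U; r f = r g\<rbrakk> \<Longrightarrow> f - g \<in> V"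
  shows "finite U \<and> card U \<le> card V * card T"
proof -
  define s where "s \<tau> = (SOME g. g \<in> U \<and> r g = \<tau>)" for \<tau>
  have s: "s (r f) \<in> U \<and> r (s (r f)) = r f" if "f \<in> U" for f
    unfolding s_def by (rule someI[of _ f]) (use that in simp)
  define h where "h f = (f - s (r f), r f)" for f
  have "inj_on h U"
    by (auto simp: inj_on_def h_def)
  moreover have "h ` U \<subseteq> V \<times> T"
    using s T diff by (fastforce simp: h_def)
  ultimately show ?thesis
    using fin card_inj_on_le[of h U "V \<times> T"] inj_on_finite[of h U "V \<times> T"]
    by (simp add: card_cartesian_product)
qed

context function_field
begin

section \<open>The subfield of constants and evaluation of polynomials\<close>

lemma hom_zero [simp]: "\<iota> 0 = 0"
  using hom_add[of 0 0] by (metis add.right_neutral add_left_imp_eq)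

declare hom_one [simp]

lemma hom_uminus: "\<iota> (- a) = - \<iota> a"
  using hom_add[of a "- a"] by (simp add: eq_neg_iff_add_eq_0 add.commute)

lemma hom_diff: "\<iota> (a - b) = \<iota> a - \<iota> b"
  using hom_add[of a "- b"] by (simp add: hom_uminus)

lemma hom_eq_0_iff [simp]: "\<iota> a = 0 \<longleftrightarrow> a = 0"
  using hom_mult[of a "inverse a"] by (cases "a = 0") auto

lemma hom_eq_iff [simp]: "\<iota> a = \<iota> b \<longleftrightarrow> a = b"
  using hom_eq_0_iff[of "a - b"] by (simp add: hom_diff)

lemma hom_inverse: "\<iota> (inverse a) = inverse (\<iota> a)"
  using hom_mult[of a "inverse a"] by (cases "a = 0") (auto intro: inverse_unique[symmetric])

sublocale vs: vector_space "\<lambda>c x. \<iota> c * x"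
  by unfold_locales (simp_all add: hom_add hom_mult algebra_simps)

definition peval :: "'a \<Rightarrow> 'k poly \<Rightarrow> 'a" where
  "peval x p = poly (map_poly \<iota> p) x"

lemma peval_0 [simp]: "peval x 0 = 0"
  by (simp add: peval_def)

lemma peval_pCons [simp]: "peval x (pCons a p) = \<iota> a + x * peval x p"
  by (simp add: peval_def map_poly_pCons)

lemma peval_add [simp]: "peval x (p + q) = peval x p + peval x q"
  by (induction p q rule: poly_induct2) (simp_all add: hom_add algebra_simps)

lemma peval_smult [simp]: "peval x (smult c p) = \<iota> c * peval x p"
  by (induction p) (simp_all add: hom_mult algebra_simps)

lemma peval_mult [simp]: "peval x (p * q) = peval x p * peval x q"
  by (induction p) (simp_all add: algebra_simps)

lemma peval_one [simp]: "peval x 1 = 1"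
  by (simp add: one_pCons)

lemma transcendental_iff: "transcendental_over \<iota> z \<longleftrightarrow> z \<notin> range \<iota>"
proof
  assume z: "transcendental_over \<iota> z"
  show "z \<notin> range \<iota>"
  proof
    assume "z \<in> range \<iota>"
    then obtain c where "z = \<iota> c" by blast
    then have "peval z [:- c, 1:] = 0" by (simp add: hom_uminus)
    then show False
      using z unfolding transcendental_over_def peval_def
      by (metis pCons_eq_0_iff zero_neq_one)
  qed
qed (use exact_constants in blast)

text \<open>Tuples are extensional functions, so that over a finite \<open>T\<close> there are
  exactly \<open>card T ^ N\<close> of them.\<close>

definition psums :: "'a \<Rightarrow> 'a set \<Rightarrow> nat \<Rightarrow> 'a set" where
  "psums y T N = (\<lambda>t. \<Sum>k<N. y ^ k * t k) ` ({..<N} \<rightarrow>\<^sub>E T)"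

text \<open>For a subspace \<open>T\<close> this says that a basis of \<open>T\<close> over the
  constants satisfies no nontrivial linear relation whose coefficients are polynomials in
  \<open>y\<close>.\<close>

definition free_over :: "'a \<Rightarrow> 'a set \<Rightarrow> bool" where
  "free_over y T \<longleftrightarrow>
     (\<forall>N t. (\<forall>k<N. t k \<in> T) \<and> (\<Sum>k<N. y ^ k * t k) = 0 \<longrightarrow> (\<forall>k<N. t k = 0))"

lemma free_overD:
  assumes "free_over y T" and "\<And>k. k < N \<Longrightarrow> t k \<in> T" and "(\<Sum>k<N. y ^ k * t k) = 0" and "k < N"
  shows "t k = 0"
  using assms unfolding free_over_def by blast

lemma card_psums:
  assumes "vs.subspace T" and "free_over y T"
  shows "card (psums y T N) = card T ^ N"
proof -
  have "inj_on (\<lambda>t. \<Sum>k<N. y ^ k * t k) ({..<N} \<rightarrow>\<^sub>E T)"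
  proof (rule inj_onI)
    fix s t
    assume s: "s \<in> {..<N} \<rightarrow>\<^sub>E T" and t: "t \<in> {..<N} \<rightarrow>\<^sub>E T"
      and eq: "(\<Sum>k<N. y ^ k * s k) = (\<Sum>k<N. y ^ k * t k)"
    have "(\<Sum>k<N. y ^ k * (s k - t k)) = 0"
      using eq by (simp add: right_diff_distrib sum_subtractf)
    moreover have "\<forall>k<N. s k - t k \<in> T"
      using s t by (auto intro!: vs.subspace_diff[OF assms(1)])
    ultimately have "\<forall>k<N. s k - t k = 0"
      using free_overD[OF assms(2), of N "\<lambda>k. s k - t k"] by blast
    then show "s = t"
      by (intro PiE_ext[OF s t]) auto
  qed
  then show ?thesis
    by (simp add: psums_def card_image card_PiE)
qed

text \<open>Multiplying a relation in \<open>inverse y\<close> by \<open>y ^ (N - 1)\<close> gives a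
  relation in \<open>y\<close> with the coefficients in reverse order.\<close>

lemma free_over_inverse:
  assumes "free_over y T" and "y \<noteq> 0"
  shows "free_over (inverse y) T"
  unfolding free_over_def
proof (intro allI impI, elim conjE)
  fix N t k
  assume t: "\<forall>k<N. t k \<in> T" and sum: "(\<Sum>k<N. inverse y ^ k * t k) = 0" and k: "k < N"
  have "(\<Sum>k<N. y ^ k * t (N - Suc k)) = (\<Sum>k<N. y ^ (N - Suc (N - Suc k)) * t (N - Suc k))"
    by (rule sum.cong) auto
  also have "\<dots> = (\<Sum>k<N. y ^ (N - Suc k) * t k)"
    by (rule sum.nat_diff_reindex)
  also have "\<dots> = (\<Sum>k<N. y ^ (N - 1) * (inverse y ^ k * t k))"
  proof (rule sum.cong)
    fix k assume "k \<in> {..<N}"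
    then have "y ^ (N - 1) = y ^ (N - Suc k) * y ^ k"
      by (simp flip: power_add)
    then show "y ^ (N - Suc k) * t k = y ^ (N - 1) * (inverse y ^ k * t k)"
      using \<open>y \<noteq> 0\<close> by (simp add: field_simps)
  qed simp
  also have "\<dots> = 0"
    by (simp add: sum flip: sum_distrib_left)
  finally have "t (N - Suc (N - Suc k)) = 0"
    using free_overD[OF assms(1), of N "\<lambda>k. t (N - Suc k)" "N - Suc k"] t k by simp
  then show "t k = 0"
    using k by (simp add: Suc_diff_Suc)
qed

text \<open>The constant term of a relation lies in both \<open>T\<close> and \<open>y H\<close>, so
  it vanishes; cancelling \<open>y\<close> leaves a shorter relation. \<open>H\<close> will be a
  maximal ideal, a valuation ring or a finite intersection of valuation rings.\<close>

lemma free_over_if_disjoint: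
  assumes T: "T \<subseteq> H" and "vs.subspace H" and stable: "\<And>h. h \<in> H \<Longrightarrow> y * h \<in> H"
    and disj: "\<And>h. \<lbrakk>h \<in> H; y * h \<in> T\<rbrakk> \<Longrightarrow> y * h = 0" and "y \<noteq> 0"
  shows "free_over y T"
proof -
  have pow: "y ^ k * h \<in> H" if "h \<in> H" for k h
    using that by (induction k) (auto simp: mult.assoc intro: stable)
  have "\<forall>k<N. t k = 0" if "\<forall>k<N. t k \<in> T" "(\<Sum>k<N. y ^ k * t k) = 0" for N t
    using that
  proof (induction N arbitrary: t)
    case (Suc N)
    define h where "h = - (\<Sum>k<N. y ^ k * t (Suc k))"
    have "h \<in> H"
      unfolding h_def using Suc.prems(1) T \<open>vs.subspace H\<close>
      by (auto intro!: vs.subspace_neg vs.subspace_sum pow)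
    have eq: "t 0 = y * h"
      using Suc.prems(2) unfolding h_def
      by (simp add: sum.lessThan_Suc_shift sum_distrib_left mult.assoc eq_neg_iff_add_eq_0
          del: sum.lessThan_Suc)
    then have "t 0 = 0"
      using disj[OF \<open>h \<in> H\<close>] Suc.prems(1) by (metis zero_less_Suc)
    moreover have "\<forall>k<N. t (Suc k) = 0"
    proof (rule Suc.IH)
      show "\<forall>k<N. t (Suc k) \<in> T"
        using Suc.prems(1) by blast
      show "(\<Sum>k<N. y ^ k * t (Suc k)) = 0"
        using eq \<open>t 0 = 0\<close> \<open>y \<noteq> 0\<close> by (simp add: h_def)
    qed
    ultimately show ?case
      by (metis less_Suc_eq_0_disj)
  qed simp
  then show ?thesis
    unfolding free_over_def by blast
qed

end

section \<open>Growth of free subspaces\<close>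

locale finite_function_field = function_field \<iota>
  for \<iota> :: "'k::{field,finite} \<Rightarrow> 'a::field"
begin

lemma card_constants_gt_1: "CARD('k) > 1"
proof -
  have "card {0, 1 :: 'k} \<le> CARD('k)"
    by (rule card_mono) auto
  then show ?thesis by simp
qed

lemma card_constants_pos [simp]: "CARD('k) > 0"
  using card_constants_gt_1 by linarith

section \<open>Finite vector spaces over the constants\<close>

lemma card_span_independent:
  assumes "finite B" and "vs.independent B"
  shows "finite (vs.span B) \<and> card (vs.span B) = CARD('k) ^ card B"
  using assms
proof (induction B rule: finite_induct)
  case (insert b B)
  have ind: "vs.independent B" "b \<notin> vs.span B"
    using insert.prems insert.hyps vs.independent_insert by auto
  define h where "h = (\<lambda>(c, s). \<iota> c * b + s)"
  have "inj_on h (UNIV \<times> vs.span B)"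
  proof (rule inj_onI, clarsimp simp: h_def)
    fix c s c' s'
    assume s: "s \<in> vs.span B" "s' \<in> vs.span B" and eq: "\<iota> c * b + s = \<iota> c' * b + s'"
    have "c = c'"
    proof (rule ccontr)
      assume "c \<noteq> c'"
      have "\<iota> (c - c') * b = s' - s"
        using eq by (simp add: hom_diff algebra_simps)
      then have "b = \<iota> (inverse (c - c')) * (s' - s)"
        using \<open>c \<noteq> c'\<close> by (metis hom_inverse hom_eq_0_iff right_minus_eq mult.assoc left_inverse mult_1)
      then show False
        using ind(2) s by (auto intro!: vs.span_scale vs.span_diff)
    qed
    then show "c = c' \<and> s = s'"
      using eq by simp
  qed
  moreover have "h ` (UNIV \<times> vs.span B) = vs.span (insert b B)"
  proof (intro equalityI subsetI)
    fix x assume "x \<in> h ` (UNIV \<times> vs.span B)"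
    then obtain c s where "x = \<iota> c * b + s" "s \<in> vs.span B"
      by (auto simp: h_def)
    then show "x \<in> vs.span (insert b B)"
      by (auto simp: vs.span_insert intro!: exI[of _ c])
  next
    fix x assume "x \<in> vs.span (insert b B)"
    then obtain c where "x - \<iota> c * b \<in> vs.span B"
      by (auto simp: vs.span_insert)
    then show "x \<in> h ` (UNIV \<times> vs.span B)"
      by (auto simp: h_def intro!: image_eqI[of _ _ "(c, x - \<iota> c * b)"])
  qed
  ultimately show ?case
    using insert.IH[OF ind(1)] insert.hyps
      card_image[of h "UNIV \<times> vs.span B"]
      finite_imageI[of "UNIV \<times> vs.span B" h]
    by (simp add: card_cartesian_product)
qed simp

lemma finite_subspace_basis:
  assumes "vs.subspace T" and "finite T"
  obtains B where "finite B" "vs.independent B" "vs.span B = T" "card B = vs.dim T"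
proof -
  obtain B where B: "B \<subseteq> T" "vs.independent B" "T \<subseteq> vs.span B" "card B = vs.dim T"
    using vs.basis_exists[of T] by blast
  show thesis
    using that[of B] B assms finite_subset[OF B(1)] vs.span_minimal[OF B(1)] by blast
qed

lemma card_subspace:
  assumes "vs.subspace T" and "finite T"
  shows "card T = CARD('k) ^ vs.dim T"
  using assms by (metis finite_subspace_basis card_span_independent)

section \<open>Polynomial combinations and common denominators\<close>

lemma card_bounded_degree_le:
  "finite {p :: 'k poly. degree p \<le> e} \<and> card {p :: 'k poly. degree p \<le> e} \<le> CARD('k) ^ Suc e"
proof -
  define L where "L = {xs :: 'k list. set xs \<subseteq> UNIV \<and> length xs = Suc e}"
  have L: "finite L" "card L = CARD('k) ^ Suc e"
    unfolding L_def using card_lists_length_eq[of "UNIV :: 'k set" "Suc e"]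
      finite_lists_length_eq[of "UNIV :: 'k set" "Suc e"] by simp_all
  have "p \<in> Poly ` L" if "degree p \<le> e" for p :: "'k poly"
  proof -
    have "p = Poly (map (coeff p) [0..<Suc e])"
      using that by (intro poly_eqI) (auto simp: nth_default_def coeff_eq_0 simp del: upt_Suc)
    moreover have "map (coeff p) [0..<Suc e] \<in> L"
      by (simp add: L_def)
    ultimately show ?thesis by blast
  qed
  then have "{p :: 'k poly. degree p \<le> e} \<subseteq> Poly ` L"
    by auto
  then show ?thesis
    using finite_surj[OF L(1)] surj_card_le[OF L(1)] L(2) by metis
qed

text \<open>The filtration by degree of the module that \<open>B\<close> generates over the
  polynomials in \<open>x\<close>. Its layers are finite, and the logarithm of their size grows
  linearly in \<open>e\<close>.\<close>

definition poly_comb :: "'a \<Rightarrow> 'a set \<Rightarrow> nat \<Rightarrow> 'a set" where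
  "poly_comb x B e = {(\<Sum>b\<in>B. peval x (p b) * b) | p. \<forall>b\<in>B. degree (p b) \<le> e}"

lemma poly_comb_add:
  assumes "u \<in> poly_comb x B e" "w \<in> poly_comb x B e"
  shows "u + w \<in> poly_comb x B e"
proof -
  obtain p r where "u = (\<Sum>b\<in>B. peval x (p b) * b)" "\<forall>b\<in>B. degree (p b) \<le> e"
    and "w = (\<Sum>b\<in>B. peval x (r b) * b)" "\<forall>b\<in>B. degree (r b) \<le> e"
    using assms unfolding poly_comb_def by blast
  then show ?thesis
    unfolding poly_comb_def
    by (intro CollectI exI[of _ "\<lambda>b. p b + r b"])
      (auto simp: sum.distrib algebra_simps intro: degree_add_le)
qed

lemma poly_comb_zero: "0 \<in> poly_comb x B e"
  unfolding poly_comb_def by (intro CollectI exI[of _ "\<lambda>b. 0"]) auto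

lemma poly_comb_sum:
  "(\<And>i. i \<in> I \<Longrightarrow> u i \<in> poly_comb x B e) \<Longrightarrow> sum u I \<in> poly_comb x B e"
  by (induction I rule: infinite_finite_induct) (auto simp: poly_comb_zero poly_comb_add)

lemma poly_comb_mono: "e \<le> e' \<Longrightarrow> poly_comb x B e \<subseteq> poly_comb x B e'"
  unfolding poly_comb_def by (auto dest: order_trans)

lemma poly_comb_mult:
  assumes "u \<in> poly_comb x B e" and "degree r \<le> d"
  shows "peval x r * u \<in> poly_comb x B (e + d)"
proof -
  obtain p where "u = (\<Sum>b\<in>B. peval x (p b) * b)" and p: "\<forall>b\<in>B. degree (p b) \<le> e"
    using assms(1) unfolding poly_comb_def by blast
  moreover have "degree (r * p b) \<le> e + d" if "b \<in> B" for b
    using degree_mult_le[of r "p b"] p that assms(2) by fastforce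
  ultimately show ?thesis
    unfolding poly_comb_def
    by (intro CollectI exI[of _ "\<lambda>b. r * p b"]) (auto simp: sum_distrib_left mult.assoc)
qed

lemma card_poly_comb_le:
  assumes "finite B"
  shows "finite (poly_comb x B e) \<and> card (poly_comb x B e) \<le> CARD('k) ^ (Suc e * card B)"
proof -
  define A where "A = B \<rightarrow>\<^sub>E {p :: 'k poly. degree p \<le> e}"
  have "poly_comb x B e \<subseteq> (\<lambda>p. \<Sum>b\<in>B. peval x (p b) * b) ` A"
  proof
    fix u assume "u \<in> poly_comb x B e"
    then obtain p where "u = (\<Sum>b\<in>B. peval x (p b) * b)" "\<forall>b\<in>B. degree (p b) \<le> e"
      unfolding poly_comb_def by blast
    then show "u \<in> (\<lambda>p. \<Sum>b\<in>B. peval x (p b) * b) ` A"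
      by (intro image_eqI[of _ _ "restrict p B"]) (auto simp: A_def)
  qed
  moreover have "finite A"
    using card_bounded_degree_le assms by (auto simp: A_def intro: finite_PiE)
  moreover have "card A \<le> CARD('k) ^ (Suc e * card B)"
    using card_bounded_degree_le[of e] assms
    unfolding A_def card_PiE[OF assms] prod_constant power_mult by (intro power_mono) auto
  ultimately show ?thesis
    using finite_surj surj_card_le order_trans by meson
qed

text \<open>Elements that some polynomial in \<open>x\<close> multiplies into the module are closed
  under sums and include all \<open>c * b\<close>, so every element is one. A single
  \<open>d\<close> bounds both the denominator and the resulting coefficients, so that
  \<open>psums_growth\<close> can use it for both.\<close>

lemma common_denominator:
  assumes gen: "\<And>y. \<exists>c. (\<forall>b\<in>B. c b \<in> simple_extension \<iota> x) \<and> y = (\<Sum>b\<in>B. c b * b)"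
    and "finite B" and "finite Z"
  obtains r d where "peval x r \<noteq> 0" "degree r \<le> d" "\<And>z. z \<in> Z \<Longrightarrow> peval x r * z \<in> poly_comb x B d"
proof -
  define good where "good z \<longleftrightarrow> (\<exists>r e. peval x r \<noteq> 0 \<and> peval x r * z \<in> poly_comb x B e)" for z
  have good_add: "good (u + w)" if uw: "good u" "good w" for u w
  proof -
    obtain r e s f where rs: "peval x r \<noteq> 0" "peval x s \<noteq> 0"
      and u: "peval x r * u \<in> poly_comb x B e" and w: "peval x s * w \<in> poly_comb x B f"
      using uw unfolding good_def by blast
    define m where "m = e + f + degree r + degree s"
    have "peval x s * (peval x r * u) \<in> poly_comb x B m"
      using poly_comb_mult[OF u order_refl, of s] poly_comb_mono[of "e + degree s" m]
      by (auto simp: m_def)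
    moreover have "peval x r * (peval x s * w) \<in> poly_comb x B m"
      using poly_comb_mult[OF w order_refl, of r] poly_comb_mono[of "f + degree r" m]
      by (auto simp: m_def)
    ultimately have "peval x (r * s) * (u + w) \<in> poly_comb x B m"
      using poly_comb_add by (fastforce simp: algebra_simps)
    then show ?thesis
      unfolding good_def using rs by (metis mult_eq_0_iff peval_mult)
  qed
  have good_sum: "(\<And>i. i \<in> I \<Longrightarrow> good (u i)) \<Longrightarrow> good (sum u I)" for I and u :: "'a \<Rightarrow> 'a"
  proof (induction I rule: infinite_finite_induct)
    case (insert i I)
    then show ?case by (auto intro: good_add)
  qed (auto simp: good_def poly_comb_zero intro!: exI[of _ 1])
  have good_gen: "good (c * b)" if c: "c \<in> simple_extension \<iota> x" and b: "b \<in> B" for b c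
  proof -
    obtain p r where "c = peval x p / peval x r" and r: "peval x r \<noteq> 0"
      using c unfolding simple_extension_def peval_def by blast
    then have eq: "peval x r * (c * b) = peval x p * b"
      by simp
    have "(\<Sum>b'\<in>B. peval x (if b' = b then p else 0) * b')
        = (\<Sum>b'\<in>B. if b' = b then peval x p * b' else 0)"
      by (rule sum.cong) auto
    also have "\<dots> = peval x p * b"
      using b \<open>finite B\<close> by simp
    finally have "peval x p * b \<in> poly_comb x B (degree p)"
      unfolding poly_comb_def
      by (intro CollectI exI[of _ "\<lambda>b'. if b' = b then p else 0"]) auto
    then show ?thesis
      unfolding good_def eq[symmetric] using r by blast
  qed
  have good: "good y" for y
  proof -
    obtain c where "\<forall>b\<in>B. c b \<in> simple_extension \<iota> x" "y = (\<Sum>b\<in>B. c b * b)"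
      using gen by blast
    then show ?thesis
      using good_sum[of B "\<lambda>b. c b * b"] good_gen by simp
  qed
  have "\<exists>r d. peval x r \<noteq> 0 \<and> degree r \<le> d \<and> (\<forall>z\<in>Z. peval x r * z \<in> poly_comb x B d)"
    using \<open>finite Z\<close>
  proof (induction Z rule: finite_induct)
    case (insert z Z)
    obtain r d where r: "peval x r \<noteq> 0" "degree r \<le> d" "\<forall>z\<in>Z. peval x r * z \<in> poly_comb x B d"
      using insert.IH by blast
    obtain s e where s: "peval x s \<noteq> 0" "peval x s * z \<in> poly_comb x B e"
      using good unfolding good_def by blast
    define m where "m = e + d + degree s"
    have "peval x (r * s) * w \<in> poly_comb x B m" if "w \<in> insert z Z" for w
    proof (cases "w = z")
      case True
      have "peval x r * (peval x s * w) \<in> poly_comb x B (e + d)"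
        using True s r by (intro poly_comb_mult) auto
      then show ?thesis
        using poly_comb_mono[of "e + d" m x B] by (auto simp: m_def mult.assoc)
    next
      case False
      have "peval x s * (peval x r * w) \<in> poly_comb x B (d + degree s)"
        using False that s r by (intro poly_comb_mult) auto
      then show ?thesis
        using poly_comb_mono[of "d + degree s" m x B] by (auto simp: m_def mult.assoc mult.left_commute)
    qed
    moreover have "degree (r * s) \<le> m"
      using degree_mult_le[of r s] r(2) by (simp add: m_def)
    ultimately show ?case
      using r(1) s(1) by (metis mult_eq_0_iff peval_mult)
  qed (auto intro!: exI[of _ 1])
  then show thesis
    using that by blast
qed

text \<open>The order of quantifiers matters: \<open>M\<close> is chosen before \<open>T\<close>. If
  \<open>r\<close> clears the denominators of \<open>y B\<close>, multiplication by
  \<open>peval x r * y\<close> raises the coefficient degree by at most \<open>d\<close>.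
  Denominators of \<open>T\<close> enter only through the constant \<open>e\<close>.\<close>

lemma psums_growth:
  "\<exists>M. \<forall>T. finite T \<longrightarrow> (\<exists>e. \<forall>N. card (psums y T N) \<le> CARD('k) ^ (M * N + e))"
proof -
  obtain x B where B: "finite B"
    and gen: "\<And>y. \<exists>c. (\<forall>b\<in>B. c b \<in> simple_extension \<iota> x) \<and> y = (\<Sum>b\<in>B. c b * b)"
    using finite_over_rational by blast
  obtain r d where r: "peval x r \<noteq> 0" "degree r \<le> d"
    and ry: "\<And>z. z \<in> (*) y ` B \<Longrightarrow> peval x r * z \<in> poly_comb x B d"
    using common_denominator[OF gen B, of "(*) y ` B"] B by blast
  have step: "peval x r * y * w \<in> poly_comb x B (e + d)" if w: "w \<in> poly_comb x B e" for e w
  proof -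
    obtain p where w_eq: "w = (\<Sum>b\<in>B. peval x (p b) * b)" and p: "\<forall>b\<in>B. degree (p b) \<le> e"
      using w unfolding poly_comb_def by blast
    have "peval x r * y * w = (\<Sum>b\<in>B. peval x (p b) * (peval x r * (y * b)))"
      unfolding w_eq by (simp add: sum_distrib_left mult_ac)
    also have "\<dots> \<in> poly_comb x B (e + d)"
      using p ry by (subst add.commute) (auto intro!: poly_comb_sum poly_comb_mult)
    finally show ?thesis .
  qed
  have "\<exists>e. \<forall>N. card (psums y T N) \<le> CARD('k) ^ (d * card B * N + e)" if "finite T" for T
  proof -
    obtain s e where s: "peval x s \<noteq> 0" "\<And>t. t \<in> T \<Longrightarrow> peval x s * t \<in> poly_comb x B e"
      using common_denominator[OF gen B \<open>finite T\<close>] by blast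
    have pow: "(peval x r * y) ^ k * (peval x s * t) \<in> poly_comb x B (e + k * d)"
      if "t \<in> T" for k t
    proof (induction k)
      case (Suc k)
      show ?case
        using step[OF Suc.IH] by (simp add: mult_ac add_ac)
    qed (use s that in simp)
    \<comment> \<open>The extra factors \<open>peval x r ^ j\<close> bring terms with different
      powers of \<open>y\<close> to the common multiplier
      \<open>peval x r ^ N * peval x s\<close>.\<close>
    have pow': "peval x r ^ (k + j) * peval x s * (y ^ k * t) \<in> poly_comb x B (e + (k + j) * d)"
      if "t \<in> T" for k j t
    proof (induction j)
      case 0
      show ?case
        using pow[OF that, of k] by (simp add: mult_ac power_mult_distrib)
    next
      case (Suc j)
      show ?case
        using poly_comb_mult[OF Suc.IH r(2)] by (simp add: mult_ac add_ac)
    qed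
    have "card (psums y T N) \<le> CARD('k) ^ (d * card B * N + (Suc e * card B))" for N
    proof -
      define c where "c = peval x r ^ N * peval x s"
      have "c \<noteq> 0"
        using r s by (simp add: c_def)
      have "(*) c ` psums y T N \<subseteq> poly_comb x B (e + N * d)"
      proof (clarsimp simp: psums_def)
        fix t assume t: "t \<in> {..<N} \<rightarrow>\<^sub>E T"
        have "c * (\<Sum>k<N. y ^ k * t k) = (\<Sum>k<N. c * (y ^ k * t k))"
          by (rule sum_distrib_left)
        also have "\<dots> \<in> poly_comb x B (e + N * d)"
        proof (rule poly_comb_sum)
          fix k assume "k \<in> {..<N}"
          then show "c * (y ^ k * t k) \<in> poly_comb x B (e + N * d)"
            using pow'[of "t k" k "N - k"] t by (auto simp: c_def)
        qed
        finally show "c * (\<Sum>k<N. y ^ k * t k) \<in> poly_comb x B (e + N * d)" .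
      qed
      moreover have "inj_on ((*) c) (psums y T N)"
        using \<open>c \<noteq> 0\<close> by (auto simp: inj_on_def)
      ultimately have "card (psums y T N) \<le> card (poly_comb x B (e + N * d))"
        using card_poly_comb_le[OF B] card_inj_on_le by blast
      also have "\<dots> \<le> CARD('k) ^ (Suc (e + N * d) * card B)"
        using card_poly_comb_le[OF B] by blast
      also have "Suc (e + N * d) * card B = d * card B * N + (Suc e * card B)"
        by (simp add: algebra_simps)
      finally show ?thesis .
    qed
    then show ?thesis by blast
  qed
  then show ?thesis by blast
qed

lemma card_free_over_bounded:
  "\<exists>M. \<forall>T. vs.subspace T \<and> finite T \<and> free_over y T \<longrightarrow> card T \<le> CARD('k) ^ M"
proof -
  obtain M where M: "\<And>T. finite T \<Longrightarrow> \<exists>e. \<forall>N. card (psums y T N) \<le> CARD('k) ^ (M * N + e)"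
    using psums_growth by blast
  have "card T \<le> CARD('k) ^ M" if T: "vs.subspace T" "finite T" "free_over y T" for T
    using M[OF T(2)] card_psums[OF T(1,3)] le_power_if_powers_le[OF _ card_constants_pos] by metis
  then show ?thesis by blast
qed

section \<open>Existence of places\<close>

definition subalgebra :: "'a set \<Rightarrow> bool" where
  "subalgebra S \<longleftrightarrow> (\<forall>c. \<iota> c \<in> S) \<and> (\<forall>a\<in>S. \<forall>b\<in>S. a + b \<in> S \<and> a * b \<in> S)"

lemma subalgebra_const [simp]: "subalgebra S \<Longrightarrow> \<iota> c \<in> S"
  by (simp add: subalgebra_def)

lemma subalgebra_0: "subalgebra S \<Longrightarrow> 0 \<in> S" and subalgebra_1: "subalgebra S \<Longrightarrow> 1 \<in> S"
  by (metis hom_zero subalgebra_const) (metis hom_one subalgebra_const)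

lemma subalgebra_add: "\<lbrakk>subalgebra S; a \<in> S; b \<in> S\<rbrakk> \<Longrightarrow> a + b \<in> S"
  and subalgebra_mult: "\<lbrakk>subalgebra S; a \<in> S; b \<in> S\<rbrakk> \<Longrightarrow> a * b \<in> S"
  by (simp_all add: subalgebra_def)

lemma subalgebra_uminus: "\<lbrakk>subalgebra S; a \<in> S\<rbrakk> \<Longrightarrow> - a \<in> S"
  using subalgebra_mult[OF _ subalgebra_const[of S "- 1"], of a] by (simp add: hom_uminus)

lemma subalgebra_diff: "\<lbrakk>subalgebra S; a \<in> S; b \<in> S\<rbrakk> \<Longrightarrow> a - b \<in> S"
  using subalgebra_add[of S a "- b"] by (simp add: subalgebra_uminus)

lemma subalgebra_power: "\<lbrakk>subalgebra S; a \<in> S\<rbrakk> \<Longrightarrow> a ^ n \<in> S"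
  by (induction n) (auto simp: subalgebra_1 subalgebra_mult)

lemma subalgebra_sum: "\<lbrakk>subalgebra S; \<And>i. i \<in> I \<Longrightarrow> u i \<in> S\<rbrakk> \<Longrightarrow> sum u I \<in> S"
  by (induction I rule: infinite_finite_induct) (auto simp: subalgebra_0 subalgebra_add)

text \<open>The relation of smaller degree obtained by eliminating the leading term of \<open>p\<close> contradicts
  the minimality of \<open>p\<close>.\<close>

lemma no_two_relations:
  assumes S: "subalgebra S" and z: "z \<in> S" "z \<noteq> 0" "inverse z \<notin> S" and "f \<noteq> 0"
    and p: "\<And>i. coeff p i \<in> (*) z ` S" "poly p f = 1"
    and r: "\<And>i. coeff r i \<in> (*) z ` S" "poly r (inverse f) = 1"
    and le: "degree r \<le> degree p"
    and minimal: "\<And>p'. \<lbrakk>\<And>i. coeff p' i \<in> (*) z ` S; poly p' f = 1\<rbrakk> \<Longrightarrow> degree p \<le> degree p'"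
  shows False
proof -
  define n a b where "n = degree p" and "a = coeff p n" and "b = coeff r 0"
  have I_S: "u \<in> S" if "u \<in> (*) z ` S" for u
    using that z(1) S by (auto intro: subalgebra_mult)
  have I_add: "u + w \<in> (*) z ` S" if uw: "u \<in> (*) z ` S" "w \<in> (*) z ` S" for u w
  proof -
    obtain u' w' where "u = z * u'" "w = z * w'" "u' \<in> S" "w' \<in> S"
      using uw by blast
    then show ?thesis
      by (intro image_eqI[of _ _ "u' + w'"]) (auto simp: algebra_simps subalgebra_add[OF S])
  qed
  have I_mult: "s * u \<in> (*) z ` S" if su: "s \<in> S" "u \<in> (*) z ` S" for s u
  proof -
    obtain u' where "u = z * u'" "u' \<in> S"
      using su by blast
    then show ?thesis
      using su by (intro image_eqI[of _ _ "s * u'"]) (auto simp: algebra_simps subalgebra_mult[OF S])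
  qed
  have I_0: "0 \<in> (*) z ` S"
    using subalgebra_0[OF S] by (intro image_eqI[of _ _ 0]) auto
  have I_sum: "(\<And>i. i \<in> J \<Longrightarrow> u i \<in> (*) z ` S) \<Longrightarrow> sum u J \<in> (*) z ` S" for u and J :: "nat set"
    by (induction J rule: infinite_finite_induct) (auto simp: I_0 I_add simp del: image_iff)
  have a: "a \<in> (*) z ` S" and b: "b \<in> (*) z ` S"
    unfolding a_def b_def using p r by blast+
  have s: "1 - b \<in> S"
    using S I_S[OF b] by (auto intro: subalgebra_diff subalgebra_1)
  have n: "n > 0"
  proof (rule ccontr)
    assume "\<not> n > 0"
    then have "p = [:a:]"
      by (metis a_def degree_0_id n_def neq0_conv)
    then have "a = 1"
      using p(2) by simp
    then obtain w where "w \<in> S" "1 = z * w"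
      using a by auto
    then show False
      using z by (metis inverse_unique)
  qed
  \<comment> \<open>Multiplying the relation for \<open>inverse f\<close> by \<open>f ^ n\<close>
    expresses \<open>(1 - b) * f ^ n\<close> through lower powers of \<open>f\<close>; this uses
    \<open>degree r \<le> n\<close>. Hence \<open>g\<close> can replace the leading term of
    \<open>smult (1 - b) p\<close>. The constant \<open>b\<close> in \<open>p'\<close> restores the
    value 1.\<close>
  define g where "g = (\<Sum>i\<in>{1..degree r}. monom (a * coeff r i) (n - i))"
  define p' where "p' = [:b:] + smult (1 - b) p + monom (- ((1 - b) * a)) n + g"
  have coeff_g: "coeff g j = (\<Sum>i\<in>{1..degree r}. if n - i = j then a * coeff r i else 0)" for j
    by (simp add: g_def coeff_sum)
  have "coeff p' i \<in> (*) z ` S" for i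
  proof -
    have "coeff [:b:] i \<in> (*) z ` S"
      using b I_0 by (cases i) auto
    moreover have "coeff (smult (1 - b) p) i \<in> (*) z ` S"
      using I_mult[OF s p(1)] by simp
    moreover have "coeff (monom (- ((1 - b) * a)) n) i \<in> (*) z ` S"
      using I_mult[OF subalgebra_uminus[OF S s] a] I_0 by (simp add: algebra_simps)
    moreover have "coeff g i \<in> (*) z ` S"
      unfolding coeff_g using I_mult[OF I_S[OF a] r(1)] I_0 by (auto intro!: I_sum)
    ultimately show ?thesis
      unfolding p'_def coeff_add by (intro I_add)
  qed
  moreover have "poly p' f = 1"
  proof -
    have "1 = (\<Sum>i\<le>degree r. coeff r i * inverse f ^ i)"
      using r(2) by (simp add: poly_altdef)
    also have "\<dots> = b + (\<Sum>i\<in>{1..degree r}. coeff r i * inverse f ^ i)"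
      by (simp add: b_def atMost_atLeast0 sum.atLeast_Suc_atMost)
    finally have *: "(\<Sum>i\<in>{1..degree r}. coeff r i * inverse f ^ i) = 1 - b"
      by (simp add: algebra_simps)
    have "poly g f = (\<Sum>i\<in>{1..degree r}. a * f ^ n * (coeff r i * inverse f ^ i))"
      unfolding g_def poly_sum
    proof (rule sum.cong)
      fix i assume "i \<in> {1..degree r}"
      then have "f ^ n = f ^ (n - i) * f ^ i"
        using le by (simp add: n_def flip: power_add)
      then show "poly (monom (a * coeff r i) (n - i)) f = a * f ^ n * (coeff r i * inverse f ^ i)"
        using \<open>f \<noteq> 0\<close> by (simp add: poly_monom field_simps)
    qed simp
    also have "\<dots> = a * f ^ n * (1 - b)"
      by (simp only: * flip: sum_distrib_left)
    finally show ?thesis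
      by (simp add: p'_def p(2) poly_monom algebra_simps)
  qed
  moreover have "degree p' \<le> n - 1"
  proof (rule degree_le, intro allI impI)
    fix i assume i: "n - 1 < i"
    have "coeff g i = 0"
      unfolding coeff_g using i n by (intro sum.neutral) auto
    then show "coeff p' i = 0"
      using i n by (cases "i = n") (auto simp: p'_def a_def n_def coeff_eq_0 pCons_one coeff_pCons split: nat.split)
  qed
  ultimately have "degree p \<le> n - 1"
    using minimal by (meson order_trans)
  then show False
    using n by (simp add: n_def)
qed

text \<open>Zorn's lemma gives a subalgebra \<open>S\<close> maximal among those that contain
  \<open>z\<close> but not \<open>inverse z\<close>; the polynomials in \<open>z\<close> are one
  because \<open>z\<close> is transcendental. If \<open>f\<close> is outside \<open>S\<close>,
  adjoining it brings in \<open>inverse z\<close>, that is, a relation \<open>poly p f = 1\<close>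
  with coefficients in \<open>z S\<close>. If \<open>f\<close> and \<open>inverse f\<close> were
  both outside, two such relations of least degree would contradict each other.\<close>

lemma exists_valuation_ring:
  assumes z: "z \<notin> range \<iota>"
  obtains S where "subalgebra S" "z \<in> S" "inverse z \<notin> S" "\<And>f. f \<in> S \<or> inverse f \<in> S"
proof -
  have z0: "z \<noteq> 0"
    using z by (metis hom_zero rangeI)
  define F where "F = {S. subalgebra S \<and> z \<in> S \<and> inverse z \<notin> S}"
  have "range (peval z) \<in> F"
    unfolding F_def
  proof (intro CollectI conjI notI)
    show "subalgebra (range (peval z))"
      unfolding subalgebra_def
    proof (intro conjI allI ballI)
      show "\<iota> c \<in> range (peval z)" for c
        by (intro range_eqI[of _ _ "[:c:]"]) simp
      show "a + b \<in> range (peval z)" "a * b \<in> range (peval z)"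
        if "a \<in> range (peval z)" "b \<in> range (peval z)" for a b
        using that by (auto simp flip: peval_add peval_mult)
    qed
    show "z \<in> range (peval z)"
      by (intro range_eqI[of _ _ "[:0, 1:]"]) simp
    assume "inverse z \<in> range (peval z)"
    then obtain p where "inverse z = peval z p" by blast
    then have "peval z (pCons (- 1) p) = 0"
      using z0 by (simp add: hom_uminus flip: \<open>inverse z = peval z p\<close>)
    moreover have "pCons (- 1) p \<noteq> 0"
      by simp
    ultimately show False
      using z transcendental_iff[of z] unfolding transcendental_over_def peval_def by blast
  qed
  moreover have "\<Union>\<C> \<in> F" if "\<C> \<noteq> {}" and ch: "subset.chain F \<C>" for \<C>
  proof -
    have sub: "\<And>S. S \<in> \<C> \<Longrightarrow> S \<in> F" and lin: "\<And>S S'. \<lbrakk>S \<in> \<C>; S' \<in> \<C>\<rbrakk> \<Longrightarrow> S \<subseteq> S' \<or> S' \<subseteq> S"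
      using ch unfolding subset.chain_def by auto
    have "subalgebra (\<Union>\<C>)"
      unfolding subalgebra_def
    proof (intro conjI allI ballI)
      show "\<iota> c \<in> \<Union>\<C>" for c
        using \<open>\<C> \<noteq> {}\<close> sub subalgebra_const unfolding F_def by blast
      fix a b assume "a \<in> \<Union>\<C>" "b \<in> \<Union>\<C>"
      then obtain S where "S \<in> \<C>" "a \<in> S" "b \<in> S"
        using lin by (metis UnionE subsetD)
      then show "a + b \<in> \<Union>\<C>" "a * b \<in> \<Union>\<C>"
        using sub[of S] by (auto simp: F_def intro: subalgebra_add subalgebra_mult)
    qed
    moreover have "z \<in> \<Union>\<C>" "inverse z \<notin> \<Union>\<C>"
      using \<open>\<C> \<noteq> {}\<close> sub unfolding F_def by blast+
    ultimately show ?thesis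
      by (simp add: F_def)
  qed
  ultimately obtain S where S: "S \<in> F" and max: "\<And>S'. \<lbrakk>S' \<in> F; S \<subseteq> S'\<rbrakk> \<Longrightarrow> S' = S"
    using subset_Zorn_nonempty[of F] by blast
  have sub: "subalgebra S" and zS: "z \<in> S" "inverse z \<notin> S"
    using S by (auto simp: F_def)
  define rel where "rel f p \<longleftrightarrow> (\<forall>i. coeff p i \<in> (*) z ` S) \<and> poly p f = 1" for f p
  have relation: "\<exists>p. rel f p" if "f \<notin> S" for f
  proof -
    define S' where "S' = {poly p f | p. \<forall>i. coeff p i \<in> S}"
    have "subalgebra S'"
      unfolding subalgebra_def
    proof (intro conjI allI ballI)
      show "\<iota> c \<in> S'" for c
        unfolding S'_def
        by (intro CollectI exI[of _ "[:\<iota> c:]"])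
          (auto simp: coeff_pCons sub subalgebra_0[OF sub] split: nat.split)
      fix a b assume "a \<in> S'" "b \<in> S'"
      then obtain p r where "a = poly p f" "\<forall>i. coeff p i \<in> S" "b = poly r f" "\<forall>i. coeff r i \<in> S"
        unfolding S'_def by blast
      moreover from this have "\<forall>i. coeff (p + r) i \<in> S" "\<forall>i. coeff (p * r) i \<in> S"
        by (auto intro!: subalgebra_add[OF sub] subalgebra_sum[OF sub] subalgebra_mult[OF sub]
            simp: coeff_mult)
      ultimately show "a + b \<in> S'" "a * b \<in> S'"
        unfolding S'_def
        by (auto intro: exI[of _ "p + r"]) (auto intro: exI[of _ "p * r"])
    qed
    moreover have "S \<subseteq> S'"
    proof
      fix s assume "s \<in> S"
      then show "s \<in> S'"
        unfolding S'_def
        by (intro CollectI exI[of _ "[:s:]"])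
          (auto simp: coeff_pCons subalgebra_0[OF sub] split: nat.split)
    qed
    moreover have "f \<in> S'"
      unfolding S'_def
      by (intro CollectI exI[of _ "[:0, 1:]"])
        (auto simp: coeff_pCons subalgebra_0[OF sub] subalgebra_1[OF sub] split: nat.split)
    ultimately have "inverse z \<in> S'"
      using max[of S'] that zS by (auto simp: F_def)
    then obtain p where p: "inverse z = poly p f" "\<forall>i. coeff p i \<in> S"
      unfolding S'_def by blast
    then have "rel f (smult z p)"
      using z0 by (auto simp: rel_def simp flip: p(1))
    then show ?thesis ..
  qed
  have "f \<in> S \<or> inverse f \<in> S" for f
  proof (rule ccontr)
    assume f: "\<not> (f \<in> S \<or> inverse f \<in> S)"
    have f0: "f \<noteq> 0"
      using f subalgebra_0[OF sub] by auto
    have ex: "\<exists>p. rel f p" "\<exists>r. rel (inverse f) r"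
      using f relation by blast+
    obtain p where p: "rel f p" "\<And>p'. rel f p' \<Longrightarrow> degree p \<le> degree p'"
      using ex(1) ex_has_least_nat[of "rel f" _ degree] by blast
    obtain r where r: "rel (inverse f) r" "\<And>r'. rel (inverse f) r' \<Longrightarrow> degree r \<le> degree r'"
      using ex(2) ex_has_least_nat[of "rel (inverse f)" _ degree] by blast
    show False
    proof (cases "degree r \<le> degree p")
      case True
      then show False
        using no_two_relations[OF sub zS(1) z0 zS(2) f0, of p r] p r by (simp add: rel_def)
    next
      case False
      then show False
        using no_two_relations[OF sub zS(1) z0 zS(2), of "inverse f" r p] f0 p r by (simp add: rel_def)
    qed
  qed
  then show thesis
    using that sub zS by blast
qed

section \<open>From the valuation ring to a discrete valuation\<close>

lemma finite_subspace_extend: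
  assumes "vs.subspace T" and "finite T"
  obtains T' where "vs.subspace T'" "finite T'" "T \<subseteq> T'" "x \<in> T'"
    "\<And>u. u \<in> T' \<Longrightarrow> \<exists>\<tau>\<in>T. \<exists>c. u = \<tau> + \<iota> c * x"
proof
  let ?T' = "vs.span (insert x T)"
  have T: "vs.span T = T"
    using assms(1) by (simp add: vs.span_eq_iff)
  show repr: "\<exists>\<tau>\<in>T. \<exists>c. u = \<tau> + \<iota> c * x" if "u \<in> ?T'" for u
  proof -
    obtain c where "u - \<iota> c * x \<in> T"
      using \<open>u \<in> ?T'\<close> by (auto simp: vs.span_insert T)
    then show ?thesis
      by (intro bexI[of _ "u - \<iota> c * x"] exI[of _ c]) auto
  qed
  have "?T' \<subseteq> (\<lambda>(\<tau>, c). \<tau> + \<iota> c * x) ` (T \<times> UNIV)"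
  proof
    fix u assume "u \<in> ?T'"
    then obtain \<tau> c where "\<tau> \<in> T" "u = \<tau> + \<iota> c * x"
      using repr by blast
    then show "u \<in> (\<lambda>(\<tau>, c). \<tau> + \<iota> c * x) ` (T \<times> UNIV)"
      by (intro image_eqI[of _ _ "(\<tau>, c)"]) auto
  qed
  then show "finite ?T'"
    by (rule finite_subset) (use assms(2) in simp)
qed (auto intro: vs.span_base)

text \<open>The largest cardinality of a subspace \<open>T \<subseteq> Q\<close> with \<open>T \<inter> x Q = 0\<close>, where \<open>Q\<close> is the
  maximal ideal, is finite and strictly decreases along proper divisors of \<open>x\<close> in \<open>Q\<close>; this makes
  the valuation ring discrete.\<close>

lemma valuation_ring_descent:
  assumes S: "subalgebra S" and val: "\<And>f. f \<in> S \<or> inverse f \<in> S"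
    and Q: "Q = {f \<in> S. f = 0 \<or> inverse f \<notin> S}"
  obtains \<mu> :: "'a \<Rightarrow> nat"
  where "\<And>x a. \<lbrakk>x \<in> Q; a \<in> Q; x \<noteq> 0; a \<noteq> 0; x / a \<in> Q\<rbrakk> \<Longrightarrow> \<mu> a < \<mu> x"
    and "vs.subspace Q" and "\<And>s f. \<lbrakk>s \<in> S; f \<in> Q\<rbrakk> \<Longrightarrow> s * f \<in> Q"
proof -
  have QS: "f \<in> S" if "f \<in> Q" for f
    using that by (simp add: Q)
  have Q_mult: "s * f \<in> Q" if sf: "s \<in> S" "f \<in> Q" for s f
  proof (cases "s * f = 0")
    case False
    have "inverse (s * f) \<notin> S"
    proof
      assume "inverse (s * f) \<in> S"
      then have "s * inverse (s * f) \<in> S"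
        using S sf(1) by (auto intro: subalgebra_mult)
      then show False
        using False sf(2) by (simp add: Q flip: mult.assoc)
    qed
    then show ?thesis
      using sf S by (auto simp: Q intro: subalgebra_mult)
  qed (use S in \<open>auto simp: Q subalgebra_0\<close>)
  \<comment> \<open>One of \<open>g / f\<close> and \<open>f / g\<close> lies in \<open>S\<close>,
    so a sum in \<open>Q\<close> is an element of \<open>S\<close> times one of its
    summands.\<close>
  have add_aux: "f + g \<in> Q" if fg: "f \<in> Q" "g \<in> Q" "f \<noteq> 0" "g / f \<in> S" for f g
  proof -
    have "(1 + g / f) * f \<in> Q"
      using fg S by (intro Q_mult subalgebra_add subalgebra_1)
    then show ?thesis
      using fg(3) by (simp add: algebra_simps)
  qed
  have Q_add: "f + g \<in> Q" if fg: "f \<in> Q" "g \<in> Q" for f g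
  proof (cases "f = 0 \<or> g = 0")
    case False
    then show ?thesis
      using val[of "g / f"] add_aux[of f g] add_aux[of g f] fg by (auto simp: add.commute)
  qed (use fg in auto)
  have Q_sub: "vs.subspace Q"
  proof (rule vs.subspaceI)
    show "0 \<in> Q"
      using S by (simp add: Q subalgebra_0)
  qed (use S Q_add Q_mult in auto)
  have unit_notin: "u \<notin> Q" if "u \<in> S" "inverse u \<in> S" "u \<noteq> 0" for u
    using that by (simp add: Q)
  define ok where "ok x T \<longleftrightarrow> vs.subspace T \<and> finite T \<and> T \<subseteq> Q \<and> (\<forall>f\<in>Q. x * f \<in> T \<longrightarrow> x * f = 0)"
    for x T
  define \<mu> where "\<mu> x = (GREATEST m. \<exists>T. ok x T \<and> card T = m)" for x
  have bounded: "\<exists>M. \<forall>m. (\<exists>T. ok x T \<and> card T = m) \<longrightarrow> m \<le> M" if x: "x \<in> Q" "x \<noteq> 0" for x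
  proof -
    obtain M where M: "\<And>T. \<lbrakk>vs.subspace T; finite T; free_over x T\<rbrakk> \<Longrightarrow> card T \<le> CARD('k) ^ M"
      using card_free_over_bounded[of x] by blast
    have "card T \<le> CARD('k) ^ M" if T: "ok x T" for T
    proof (rule M)
      show "free_over x T"
        using T x QS[OF x(1)] Q_mult Q_sub
        by (intro free_over_if_disjoint[of T Q x]) (auto simp: ok_def)
    qed (use T in \<open>auto simp: ok_def\<close>)
    then show ?thesis by blast
  qed
  have "ok x {0}" for x
    using Q_sub vs.subspace_0 by (auto simp: ok_def intro!: vs.subspaceI)
  then have attained: "\<exists>T. ok x T \<and> card T = \<mu> x" if x: "x \<in> Q" "x \<noteq> 0" for x
  proof -
    obtain M where "\<And>m. (\<exists>T. ok x T \<and> card T = m) \<Longrightarrow> m \<le> M"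
      using bounded[OF x] by blast
    then show ?thesis
      unfolding \<mu>_def using GreatestI_ex_nat[of "\<lambda>m. \<exists>T. ok x T \<and> card T = m" M] \<open>\<And>x. ok x {0}\<close> by blast
  qed
  have upper: "card T \<le> \<mu> x" if x: "x \<in> Q" "x \<noteq> 0" and T: "ok x T" for x T
  proof -
    obtain M where "\<And>m. (\<exists>T. ok x T \<and> card T = m) \<Longrightarrow> m \<le> M"
      using bounded[OF x] by blast
    then show ?thesis
      unfolding \<mu>_def using Greatest_le_nat[of "\<lambda>m. \<exists>T. ok x T \<and> card T = m" "card T" M] T by blast
  qed
  have "\<mu> a < \<mu> x" if xa: "x \<in> Q" "a \<in> Q" "x \<noteq> 0" "a \<noteq> 0" "x / a \<in> Q" for x a
  proof -
    obtain T where T: "ok a T" "card T = \<mu> a"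
      using attained xa by blast
    then have sub: "vs.subspace T" "finite T" and TQ: "T \<subseteq> Q"
      and disj: "\<And>f. \<lbrakk>f \<in> Q; a * f \<in> T\<rbrakk> \<Longrightarrow> a * f = 0"
      by (auto simp: ok_def)
    obtain T' where T': "vs.subspace T'" "finite T'" "T \<subseteq> T'" "x \<in> T'"
      and repr: "\<And>u. u \<in> T' \<Longrightarrow> \<exists>\<tau>\<in>T. \<exists>c. u = \<tau> + \<iota> c * x"
      using finite_subspace_extend[OF sub, of x] by blast
    \<comment> \<open>Since \<open>x = a * (x / a)\<close> lies in \<open>a Q\<close>, which
      \<open>T\<close> avoids, adjoining \<open>x\<close> to a largest \<open>T\<close> for
      \<open>a\<close> gives a strictly larger candidate for \<open>x\<close>.\<close>
    have "x \<notin> T"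
      using disj[of "x / a"] xa by auto
    then have "card T < card T'"
      using T' by (intro psubset_card_mono) auto
    also have "ok x T'"
      unfolding ok_def
    proof (intro conjI ballI impI)
      show "T' \<subseteq> Q"
        using repr TQ xa(1) Q_sub by (fastforce intro: vs.subspace_add vs.subspace_scale)
      fix f assume f: "f \<in> Q" "x * f \<in> T'"
      obtain \<tau> c where \<tau>: "\<tau> \<in> T" "x * f = \<tau> + \<iota> c * x"
        using repr[OF f(2)] by blast
      \<comment> \<open>The relation reads \<open>\<tau> = x * (f - \<iota> c)\<close>, which lies
        in \<open>a Q\<close>. So \<open>\<tau>\<close> is 0 and \<open>f\<close> is a constant in
        \<open>Q\<close>; nonzero constants are units.\<close>
      have "f - \<iota> c \<in> S"
        using QS[OF f(1)] S by (auto intro: subalgebra_diff)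
      then have "(f - \<iota> c) * (x / a) \<in> Q"
        using xa by (intro Q_mult) auto
      moreover have "a * ((f - \<iota> c) * (x / a)) = \<tau>"
        using xa \<tau>(2) by (simp add: field_simps)
      ultimately have "\<tau> = 0"
        using disj \<tau>(1) by metis
      then have "f = \<iota> c"
        using \<tau>(2) xa(3) by simp
      then have "c = 0"
        using unit_notin[of "\<iota> c"] f(1) S by (metis hom_eq_0_iff hom_inverse subalgebra_const)
      then show "x * f = 0"
        using \<open>f = \<iota> c\<close> by simp
    qed (use T' in auto)
    then have "card T' \<le> \<mu> x"
      using upper xa by blast
    finally show ?thesis
      using T(2) by simp
  qed
  then show thesis
    using that Q_sub Q_mult by blast
qed

text \<open>A nonzero \<open>t\<close> in \<open>Q\<close> of least \<open>\<mu>\<close> divides all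
  of \<open>Q\<close>: if \<open>a / t\<close> were not in \<open>S\<close>, then
  \<open>t / a\<close> would lie in \<open>Q\<close> and \<open>\<mu> a\<close> would be smaller.
  Repeated division by \<open>t\<close> lowers \<open>\<mu>\<close>, so every nonzero element is a
  unit times a power of \<open>t\<close>, and the exponent is the valuation.\<close>

lemma exists_zero:
  assumes z: "z \<notin> range \<iota>"
  obtains v where "v \<in> places \<iota>" "v z > 0"
proof -
  have z0: "z \<noteq> 0"
    using z by (metis hom_zero rangeI)
  obtain S where S: "subalgebra S" and zS: "z \<in> S" "inverse z \<notin> S"
    and val: "\<And>f. f \<in> S \<or> inverse f \<in> S"
    using exists_valuation_ring[OF z] by blast
  define Q where "Q = {f \<in> S. f = 0 \<or> inverse f \<notin> S}"
  obtain \<mu> :: "'a \<Rightarrow> nat"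
    where \<mu>: "\<And>x a. \<lbrakk>x \<in> Q; a \<in> Q; x \<noteq> 0; a \<noteq> 0; x / a \<in> Q\<rbrakk> \<Longrightarrow> \<mu> a < \<mu> x"
      and Q_sub: "vs.subspace Q" and Q_mult: "\<And>s f. \<lbrakk>s \<in> S; f \<in> Q\<rbrakk> \<Longrightarrow> s * f \<in> Q"
    using valuation_ring_descent[OF S val Q_def] by blast
  have zQ: "z \<in> Q"
    using zS by (simp add: Q_def)
  obtain t where t: "t \<in> Q" "t \<noteq> 0" and t_min: "\<And>a. \<lbrakk>a \<in> Q; a \<noteq> 0\<rbrakk> \<Longrightarrow> \<mu> t \<le> \<mu> a"
    using ex_has_least_nat[of "\<lambda>a. a \<in> Q \<and> a \<noteq> 0" z \<mu>] zQ z0 by blast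
  define unit where "unit u \<longleftrightarrow> u \<noteq> 0 \<and> u \<in> S \<and> inverse u \<in> S" for u
  have unit_mult: "unit (u * w)" if "unit u" "unit w" for u w
    using that S by (auto simp: unit_def intro: subalgebra_mult)
  have unit_inverse: "unit (inverse u)" if "unit u" for u
    using that by (auto simp: unit_def)
  have tS: "t \<in> S" "inverse t \<notin> S"
    using t by (auto simp: Q_def)
  have div_t: "a / t \<in> S" if a: "a \<in> Q" for a
  proof (rule ccontr)
    assume *: "a / t \<notin> S"
    then have "a \<noteq> 0"
      using S by (auto simp: subalgebra_0)
    have "t / a \<in> S"
      using val[of "a / t"] * by simp
    then have "t / a \<in> Q"
      using * by (simp add: Q_def)
    then have "\<mu> a < \<mu> t"
      using \<mu> t a \<open>a \<noteq> 0\<close> by blast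
    then show False
      using t_min[OF a \<open>a \<noteq> 0\<close>] by simp
  qed
  have repr_nat: "\<exists>n::nat. unit (f / t ^ n)" if "f \<in> S" "f \<noteq> 0" for f
    using that
  proof (induction "\<mu> f" arbitrary: f rule: less_induct)
    case less
    show ?case
    proof (cases "f \<in> Q")
      case False
      then have "unit (f / t ^ 0)"
        using less.prems by (simp add: unit_def Q_def)
      then show ?thesis ..
    next
      case True
      note f = True
      show ?thesis
      proof (cases "f / t \<in> Q")
        case False
        then have "unit (f / t ^ 1)"
          using div_t[OF f] less.prems t by (simp add: unit_def Q_def)
        then show ?thesis ..
      next
        case True
        have "\<mu> (f / t) < \<mu> f"
          using \<mu>[OF f True] less.prems t by simp
        then obtain n where "unit (f / t / t ^ n)"
          using less.hyps div_t[OF f] less.prems t by (metis divide_eq_0_iff)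
        then have "unit (f / t ^ Suc n)"
          by simp
        then show ?thesis ..
      qed
    qed
  qed
  have repr: "\<exists>n::int. unit (f * t powi (- n))" if f0: "f \<noteq> 0" for f
  proof (cases "f \<in> S")
    case True
    then obtain n where "unit (f / t ^ n)"
      using repr_nat f0 by blast
    then have "unit (f * t powi (- int n))"
      by (simp add: power_int_minus divide_inverse)
    then show ?thesis ..
  next
    case False
    then obtain n where "unit (inverse f / t ^ n)"
      using repr_nat[of "inverse f"] val[of f] f0 by auto
    then have "unit (inverse (inverse f / t ^ n))"
      by (rule unit_inverse)
    then have "unit (f * t powi (- (- int n)))"
      by (simp add: divide_inverse)
    then show ?thesis ..
  qed
  have powi_unit: "n = 0" if "unit (t powi n)" for n
  proof (rule ccontr)
    assume "n \<noteq> 0"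
    have pos: False if n: "n > 0" "unit (t powi n)" for n :: int
    proof -
      have "nat n = Suc (nat (n - 1))"
        using n(1) by simp
      then have "t powi n = t * t ^ nat (n - 1)"
        using n(1) by (simp add: power_int_def)
      then have "inverse t = t ^ nat (n - 1) * inverse (t powi n)"
        using t(2) by (simp add: field_simps)
      also have "\<dots> \<in> S"
        using n(2) S tS by (intro subalgebra_mult subalgebra_power) (auto simp: unit_def)
      finally show False
        using tS by simp
    qed
    have "unit (t powi (- n))"
      using unit_inverse[OF \<open>unit (t powi n)\<close>] by (simp add: power_int_minus)
    then show False
      using \<open>n \<noteq> 0\<close> pos[of n] pos[of "- n"] \<open>unit (t powi n)\<close> by linarith
  qed
  define v where "v f = (if f = 0 then 0 else (THE n. unit (f * t powi (- n))))" for f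
  have v_eq: "v f = n" if u: "unit (f * t powi (- n))" for f n
  proof -
    have "m = n" if m: "unit (f * t powi (- m))" for m
    proof -
      have "f \<noteq> 0"
        using u by (auto simp: unit_def)
      have "unit (f * t powi (- n) * inverse (f * t powi (- m)))"
        by (intro unit_mult unit_inverse u m)
      also have "f * t powi (- n) * inverse (f * t powi (- m)) = t powi (m - n)"
        using \<open>f \<noteq> 0\<close> t(2) by (simp add: power_int_minus power_int_diff field_simps)
      finally show ?thesis
        using powi_unit by fastforce
    qed
    then have "(THE n. unit (f * t powi (- n))) = n"
      using u by blast
    moreover have "f \<noteq> 0"
      using u by (auto simp: unit_def)
    ultimately show ?thesis
      by (simp add: v_def)
  qed
  have v_unit: "unit (f * t powi (- v f))" if "f \<noteq> 0" for f
    using repr[OF that] v_eq by metis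
  have v_mult: "v (f * g) = v f + v g" if "f \<noteq> 0" "g \<noteq> 0" for f g
  proof (rule v_eq)
    have "f * g * t powi (- (v f + v g)) = (f * t powi (- v f)) * (g * t powi (- v g))"
      using t(2) by (simp add: power_int_add power_int_diff power_int_minus field_simps)
    then show "unit (f * g * t powi (- (v f + v g)))"
      using unit_mult v_unit that by metis
  qed
  have v_nonneg: "v f \<ge> 0 \<longleftrightarrow> f \<in> S" if f0: "f \<noteq> 0" for f
  proof
    assume "f \<in> S"
    then obtain n where "unit (f / t ^ n)"
      using repr_nat f0 by blast
    then have "v f = int n"
      by (intro v_eq) (simp add: power_int_minus divide_inverse)
    then show "v f \<ge> 0" by simp
  next
    assume "v f \<ge> 0"
    then have "f = f * t powi (- v f) * t ^ nat (v f)"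
      using t(2) by (simp add: power_int_minus power_int_def field_simps)
    also have "\<dots> \<in> S"
      using v_unit[OF that] subalgebra_mult[OF S _ subalgebra_power[OF S tS(1)]]
      unfolding unit_def by blast
    finally show "f \<in> S" .
  qed
  have v_one: "v 1 = 0"
    by (intro v_eq) (simp add: unit_def subalgebra_1[OF S])
  have v_add_aux: "v f \<le> v (f + g)" if fg: "f \<noteq> 0" "g \<noteq> 0" "f + g \<noteq> 0" "v f \<le> v g" for f g
  proof -
    have "g = f * (g / f)" "f + g = f * (1 + g / f)"
      using fg by (simp_all add: field_simps)
    moreover have "1 + g / f \<noteq> 0"
      using calculation(2) fg(3) by force
    ultimately have "v g = v f + v (g / f)" "v (f + g) = v f + v (1 + g / f)"
      using v_mult fg by (metis divide_eq_0_iff)+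
    moreover have "v (1 + g / f) \<ge> 0"
      using v_nonneg[of "g / f"] v_nonneg[of "1 + g / f"] calculation(1) fg \<open>1 + g / f \<noteq> 0\<close> S
      by (auto intro: subalgebra_add subalgebra_1)
    ultimately show ?thesis by simp
  qed
  have "v \<in> places \<iota>"
    unfolding places_def
  proof (intro CollectI conjI allI impI; (elim conjE)?)
    show "v 0 = 0"
      by (simp add: v_def)
    show "v (x * y) = v x + v y" if "x \<noteq> 0" "y \<noteq> 0" for x y
      using v_mult that by blast
    show "min (v x) (v y) \<le> v (x + y)" if "x \<noteq> 0" "y \<noteq> 0" "x + y \<noteq> 0" for x y
      using v_add_aux[of x y] v_add_aux[of y x] that by (cases "v x \<le> v y") (auto simp: add.commute)
    show "v (\<iota> c) = 0" if "c \<noteq> 0" for c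
      using that S by (intro v_eq) (simp add: unit_def flip: hom_inverse)
    show "\<exists>t. t \<noteq> 0 \<and> v t = 1"
      using t(2) by (intro exI[of _ t] conjI v_eq) (auto simp: unit_def subalgebra_1[OF S] power_int_minus)
  qed
  moreover have "v z > 0"
  proof -
    have "v z \<ge> 0"
      using v_nonneg[OF z0] zS by simp
    moreover have "v z \<noteq> 0"
      using v_unit[OF z0] zS by (auto simp: unit_def)
    ultimately show ?thesis by simp
  qed
  ultimately show thesis
    using that by blast
qed

end

section \<open>Valuations and residue fields\<close>

text \<open>Gives 0 the value infinity in place of the dummy \<open>v 0\<close>, so that the rules
  for sums and products need no case distinction.\<close>

definition val_ge :: "('a::field \<Rightarrow> int) \<Rightarrow> int \<Rightarrow> 'a \<Rightarrow> bool" where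
  "val_ge v n x \<longleftrightarrow> x = 0 \<or> n \<le> v x"

lemma val_ge_0 [simp]: "val_ge v n 0"
  by (simp add: val_ge_def)

lemma val_ge_mono: "val_ge v n x \<Longrightarrow> m \<le> n \<Longrightarrow> val_ge v m x"
  by (auto simp: val_ge_def)

lemma valuation_ring_iff: "x \<in> valuation_ring v \<longleftrightarrow> val_ge v 0 x"
  by (simp add: valuation_ring_def val_ge_def)

lemma maximal_ideal_iff: "x \<in> maximal_ideal v \<longleftrightarrow> val_ge v 1 x"
  by (auto simp: maximal_ideal_def val_ge_def)

context function_field
begin

context
  fixes v
  assumes v: "v \<in> places \<iota>"
begin

lemma place_mult: "x \<noteq> 0 \<Longrightarrow> y \<noteq> 0 \<Longrightarrow> v (x * y) = v x + v y"
  and place_const: "v (\<iota> c) = 0"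
  using v by (auto simp: places_def) (metis hom_zero)

lemma place_one [simp]: "v 1 = 0"
  using place_const[of 1] by simp

lemma place_inverse: "v (inverse x) = - v x"
proof (cases "x = 0")
  case False
  then show ?thesis
    using place_mult[of x "inverse x"] place_one by simp
qed (use v in \<open>simp add: places_def\<close>)

lemma place_power: "x \<noteq> 0 \<Longrightarrow> v (x ^ n) = int n * v x"
  by (induction n) (auto simp: place_mult place_one algebra_simps)

lemma place_uniformizer: obtains t where "t \<noteq> 0" "v t = 1"
  using v by (auto simp: places_def)

lemma exists_place_eq: obtains h where "h \<noteq> 0" "v h = n"
proof -
  obtain t where t: "t \<noteq> 0" "v t = 1"
    by (rule place_uniformizer)
  show thesis
  proof (cases "n \<ge> 0")
    case True
    then show thesis
      using that[of "t ^ nat n"] t by (simp add: place_power)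
  next
    case False
    then show thesis
      using that[of "inverse (t ^ nat (- n))"] t by (simp add: place_power place_inverse)
  qed
qed

lemma val_ge_add: "val_ge v n x \<Longrightarrow> val_ge v n y \<Longrightarrow> val_ge v n (x + y)"
proof -
  assume xy: "val_ge v n x" "val_ge v n y"
  have "min (v x) (v y) \<le> v (x + y)" if "x \<noteq> 0" "y \<noteq> 0" "x + y \<noteq> 0"
    using v that by (auto simp: places_def)
  then show ?thesis
    using xy by (fastforce simp: val_ge_def)
qed

lemma val_ge_mult: "val_ge v n x \<Longrightarrow> val_ge v m y \<Longrightarrow> val_ge v (n + m) (x * y)"
  by (cases "x = 0"; cases "y = 0") (auto simp: val_ge_def place_mult)

lemma val_ge_const: "val_ge v 0 (\<iota> c)"
  by (simp add: val_ge_def place_const)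

lemma val_ge_scale: "val_ge v n x \<Longrightarrow> val_ge v n (\<iota> c * x)"
  using val_ge_mult[OF val_ge_const] by fastforce

lemma val_ge_subspace: "vs.subspace {x. val_ge v n x}"
  by (intro vs.subspaceI) (auto intro: val_ge_add val_ge_scale)

lemma val_ge_diff: "val_ge v n x \<Longrightarrow> val_ge v n y \<Longrightarrow> val_ge v n (x - y)"
  using vs.subspace_diff[OF val_ge_subspace[of n], of x y] by simp

lemma val_ge_sum: "(\<And>i. i \<in> I \<Longrightarrow> val_ge v n (u i)) \<Longrightarrow> val_ge v n (sum u I)"
  using vs.subspace_sum[OF val_ge_subspace[of n], of I u] by simp

lemma val_ge_power: "val_ge v n x \<Longrightarrow> val_ge v (int k * n) (x ^ k)"
proof (induction k)
  case (Suc k)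
  then show ?case
    using val_ge_mult[of n x "int k * n" "x ^ k"] by (simp add: algebra_simps)
qed (simp add: val_ge_def)

lemma val_ge_divide_iff: "h \<noteq> 0 \<Longrightarrow> val_ge v n (x / h) \<longleftrightarrow> val_ge v (n + v h) x"
  by (cases "x = 0") (auto simp: val_ge_def divide_inverse place_mult place_inverse)

lemma val_ge_mult_iff: "h \<noteq> 0 \<Longrightarrow> val_ge v n (h * x) \<longleftrightarrow> val_ge v (n - v h) x"
  by (cases "x = 0") (auto simp: val_ge_def place_mult)

lemma place_add_eq:
  assumes "x \<noteq> 0" and "val_ge v (v x + 1) y"
  shows "x + y \<noteq> 0 \<and> v (x + y) = v x"
proof -
  have "\<not> val_ge v (v x + 1) (x + y)"
    using val_ge_diff[of "v x + 1" "x + y" y] assms by (auto simp: val_ge_def)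
  moreover have "val_ge v (v x) (x + y)"
    using assms by (intro val_ge_add) (auto simp: val_ge_def)
  ultimately show ?thesis
    by (auto simp: val_ge_def)
qed

end

end

context finite_function_field
begin

text \<open>A subspace of the valuation ring that meets the maximal ideal only in 0 is free over a
  uniformizer, so its size is bounded. A largest one represents every residue class, since an
  element of a missed class could be adjoined.\<close>

lemma residue_transversal_exists:
  assumes v: "v \<in> places \<iota>"
  obtains T where "vs.subspace T" "finite T" "\<And>x. x \<in> T \<Longrightarrow> val_ge v 0 x"
    "\<And>x. \<lbrakk>x \<in> T; val_ge v 1 x\<rbrakk> \<Longrightarrow> x = 0"
    "\<And>x. val_ge v 0 x \<Longrightarrow> \<exists>\<tau>\<in>T. val_ge v 1 (x - \<tau>)"
proof -
  define ok where "ok T \<longleftrightarrow> vs.subspace T \<and> finite T \<and> (\<forall>x\<in>T. val_ge v 0 x \<and> (val_ge v 1 x \<longrightarrow> x = 0))"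
    for T
  obtain t where t: "t \<noteq> 0" "v t = 1"
    by (rule place_uniformizer[OF v])
  obtain M where M: "\<And>T. \<lbrakk>vs.subspace T; finite T; free_over t T\<rbrakk> \<Longrightarrow> card T \<le> CARD('k) ^ M"
    using card_free_over_bounded[of t] by blast
  have bound: "card T \<le> CARD('k) ^ M" if T: "ok T" for T
  proof (rule M)
    show "free_over t T"
    proof (rule free_over_if_disjoint)
      show "T \<subseteq> {x. val_ge v 0 x}"
        using T by (auto simp: ok_def)
      show "vs.subspace {x. val_ge v 0 x}"
        by (rule val_ge_subspace[OF v])
      show "t * h = 0"
        if "h \<in> {x. val_ge v 0 x}" "t * h \<in> T" for h
        using that T t by (auto simp: val_ge_mult_iff[OF v] ok_def intro: val_ge_mono)
      show "t * h \<in> {x. val_ge v 0 x}" if "h \<in> {x. val_ge v 0 x}" for h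
        using that t by (auto simp: val_ge_mult_iff[OF v] intro: val_ge_mono)
    qed (rule t)
  qed (use T in \<open>auto simp: ok_def\<close>)
  have "ok {0}"
    by (auto simp: ok_def intro!: vs.subspaceI)
  then obtain T where T: "ok T" and max: "\<And>T'. ok T' \<Longrightarrow> card T' \<le> card T"
    using ex_has_greatest_nat[of ok "{0}" card "CARD('k) ^ M + 1"] bound by (metis Suc_eq_plus1 less_Suc_eq_le)
  have sub: "vs.subspace T" "finite T"
    using T by (auto simp: ok_def)
  have "\<exists>\<tau>\<in>T. val_ge v 1 (x - \<tau>)" if x: "val_ge v 0 x" for x
  proof (rule ccontr)
    assume no: "\<not> (\<exists>\<tau>\<in>T. val_ge v 1 (x - \<tau>))"
    obtain T' where T': "vs.subspace T'" "finite T'" "T \<subseteq> T'" "x \<in> T'"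
      and repr: "\<And>u. u \<in> T' \<Longrightarrow> \<exists>\<tau>\<in>T. \<exists>c. u = \<tau> + \<iota> c * x"
      using finite_subspace_extend[OF sub, of x] by blast
    have "x \<notin> T"
      using no by force
    then have "card T < card T'"
      using T' by (intro psubset_card_mono) auto
    moreover have "ok T'"
      unfolding ok_def
    proof (intro conjI ballI impI)
      fix u assume "u \<in> T'"
      then obtain \<tau> c where u: "\<tau> \<in> T" "u = \<tau> + \<iota> c * x"
        using repr by blast
      then show "val_ge v 0 u"
        using T x by (auto simp: ok_def intro!: val_ge_add[OF v] val_ge_scale[OF v])
      assume ge: "val_ge v 1 u"
      have "c = 0"
      proof (rule ccontr)
        assume "c \<noteq> 0"
        then have "\<iota> (inverse c) * u = x - \<iota> (- inverse c) * \<tau>"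
          by (simp add: u(2) hom_inverse hom_uminus distrib_left flip: mult.assoc)
        then have "val_ge v 1 (x - \<iota> (- inverse c) * \<tau>)"
          using val_ge_scale[OF v ge] by metis
        then show False
          using no vs.subspace_scale[OF sub(1) u(1)] by blast
      qed
      then show "u = 0"
        using u ge T by (auto simp: ok_def)
    qed (use T' in auto)
    ultimately show False
      using max by fastforce
  qed
  then show thesis
    using that[of T] T by (auto simp: ok_def)
qed

text \<open>Uniqueness of the coordinates of 0 gives linear independence and trivial intersection
  with the maximal ideal; their existence gives a representative of every class.\<close>

lemma residue_basis_span:
  assumes v: "v \<in> places \<iota>" and B: "residue_basis \<iota> v B"
  shows "finite (vs.span B)" "card (vs.span B) = CARD('k) ^ card B"
    "\<And>x. x \<in> vs.span B \<Longrightarrow> val_ge v 0 x" "\<And>x. \<lbrakk>x \<in> vs.span B; val_ge v 1 x\<rbrakk> \<Longrightarrow> x = 0"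
    "\<And>x. val_ge v 0 x \<Longrightarrow> \<exists>\<tau>\<in>vs.span B. val_ge v 1 (x - \<tau>)"
proof -
  have fin: "finite B" and B0: "\<And>b. b \<in> B \<Longrightarrow> val_ge v 0 b"
    and ex: "\<And>x. val_ge v 0 x \<Longrightarrow> \<exists>!c. (\<forall>b. b \<notin> B \<longrightarrow> c b = 0) \<and> val_ge v 1 (x - (\<Sum>b\<in>B. \<iota> (c b) * b))"
    using B by (auto simp: residue_basis_def valuation_ring_iff maximal_ideal_iff)
  have zero: "c b = 0" if c: "val_ge v 1 (\<Sum>b\<in>B. \<iota> (c b) * b)" and b: "b \<in> B" for c b
  proof -
    \<comment> \<open>Uniqueness in \<open>residue_basis\<close> concerns coefficient functions that
      vanish outside \<open>B\<close>, so \<open>c\<close> is cut off first.\<close>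
    define c' where "c' b = (if b \<in> B then c b else 0)" for b
    have eq: "(\<Sum>b\<in>B. \<iota> (c' b) * b) = (\<Sum>b\<in>B. \<iota> (c b) * b)"
      by (rule sum.cong) (auto simp: c'_def)
    have "val_ge v 1 (0 - (\<Sum>b\<in>B. \<iota> (c' b) * b))"
      unfolding eq using c by (intro val_ge_diff[OF v]) auto
    moreover have "\<forall>b. b \<notin> B \<longrightarrow> c' b = 0"
      by (simp add: c'_def)
    ultimately have "c' = (\<lambda>_. 0)"
      using ex1E[OF ex[of 0]] by (metis (mono_tags, lifting) val_ge_0 diff_zero hom_zero mult_zero_left sum.neutral)
    then show ?thesis
      using b by (metis c'_def)
  qed
  have ind: "vs.independent B"
    unfolding vs.independent_explicit_finite_subsets
  proof (intro allI impI ballI)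
    fix S u b assume S: "S \<subseteq> B" "finite S" "(\<Sum>w\<in>S. \<iota> (u w) * w) = 0" "b \<in> S"
    have "(\<Sum>w\<in>B. \<iota> (if w \<in> S then u w else 0) * w) = (\<Sum>w\<in>B. if w \<in> S then \<iota> (u w) * w else 0)"
      by (rule sum.cong) auto
    also have "\<dots> = (\<Sum>w\<in>S. \<iota> (u w) * w)"
      using S(1) fin by (simp add: sum.If_cases Int_absorb1)
    finally show "u b = 0"
      using zero[of "\<lambda>w. if w \<in> S then u w else 0" b] S by auto
  qed
  show "finite (vs.span B)" "card (vs.span B) = CARD('k) ^ card B"
    using card_span_independent[OF fin ind] by auto
  have span: "vs.span B = range (\<lambda>u. \<Sum>w\<in>B. \<iota> (u w) * w)"
    using vs.span_finite[OF fin] .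
  show "val_ge v 0 x" if "x \<in> vs.span B" for x
    using that B0 by (auto simp: span intro!: val_ge_sum[OF v] val_ge_scale[OF v])
  show "x = 0" if "x \<in> vs.span B" "val_ge v 1 x" for x
    using that zero by (auto simp: span intro!: sum.neutral)
  show "\<exists>\<tau>\<in>vs.span B. val_ge v 1 (x - \<tau>)" if "val_ge v 0 x" for x
    using ex[OF that] by (auto simp: span)
qed

lemma residue_basis_exists:
  assumes v: "v \<in> places \<iota>"
  obtains B where "residue_basis \<iota> v B"
proof -
  obtain T where T: "vs.subspace T" "finite T" "\<And>x. x \<in> T \<Longrightarrow> val_ge v 0 x"
    and disj: "\<And>x. \<lbrakk>x \<in> T; val_ge v 1 x\<rbrakk> \<Longrightarrow> x = 0"
    and cover: "\<And>x. val_ge v 0 x \<Longrightarrow> \<exists>\<tau>\<in>T. val_ge v 1 (x - \<tau>)"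
    using residue_transversal_exists[OF v] by blast
  obtain B where B: "finite B" "vs.independent B" "vs.span B = T"
    using finite_subspace_basis[OF T(1,2)] by blast
  have span: "T = range (\<lambda>u. \<Sum>w\<in>B. \<iota> (u w) * w)"
    using vs.span_finite[OF B(1)] B(3) by simp
  have "residue_basis \<iota> v B"
    unfolding residue_basis_def
  proof (intro conjI ballI)
    show "B \<subseteq> valuation_ring v"
      using vs.span_superset[of B] B T by (auto simp: valuation_ring_iff)
    fix x assume "x \<in> valuation_ring v"
    then obtain \<tau> where \<tau>: "\<tau> \<in> T" "val_ge v 1 (x - \<tau>)"
      using cover by (auto simp: valuation_ring_iff)
    then obtain u where u: "\<tau> = (\<Sum>w\<in>B. \<iota> (u w) * w)"
      using span by blast
    define c where "c b = (if b \<in> B then u b else 0)" for b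
    have c: "\<tau> = (\<Sum>w\<in>B. \<iota> (c w) * w)"
      unfolding u by (rule sum.cong) (auto simp: c_def)
    show "\<exists>!c. (\<forall>b. b \<notin> B \<longrightarrow> c b = 0) \<and> x - (\<Sum>b\<in>B. \<iota> (c b) * b) \<in> maximal_ideal v"
    proof (rule ex1I[of _ c])
      show "(\<forall>b. b \<notin> B \<longrightarrow> c b = 0) \<and> x - (\<Sum>b\<in>B. \<iota> (c b) * b) \<in> maximal_ideal v"
        using \<tau>(2) by (simp add: maximal_ideal_iff c[symmetric]) (simp add: c_def)
      fix c' assume c': "(\<forall>b. b \<notin> B \<longrightarrow> c' b = 0) \<and> x - (\<Sum>b\<in>B. \<iota> (c' b) * b) \<in> maximal_ideal v"
      define \<tau>' where "\<tau>' = (\<Sum>b\<in>B. \<iota> (c' b) * b)"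
      have "\<tau>' \<in> T"
        unfolding \<tau>'_def span by blast
      have "val_ge v 1 ((x - \<tau>) - (x - \<tau>'))"
        using c' by (intro val_ge_diff[OF v \<tau>(2)]) (simp add: maximal_ideal_iff \<tau>'_def)
      then have "\<tau>' - \<tau> = 0"
        using \<tau>(1) \<open>\<tau>' \<in> T\<close> T(1) by (intro disj) (auto intro: vs.subspace_diff)
      then have "(\<Sum>b\<in>B. \<iota> (c' b - c b) * b) = 0"
        unfolding \<tau>'_def c by (simp add: hom_diff sum_subtractf algebra_simps)
      then have "c' b - c b = 0" if "b \<in> B" for b
        using vs.independentD[OF B(2) B(1) subset_refl, of "\<lambda>b. c' b - c b"] that by simp
      then show "c' = c"
        using c' by (auto simp: c_def fun_eq_iff)
    qed
  qed (rule B)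
  then show thesis
    by (rule that)
qed

text \<open>Replacing an element of one span by its representative in another is injective, so any
  two residue bases have the same size and the description in \<open>place_degree\<close>
  denotes.\<close>

lemma place_degree_eq_card:
  assumes v: "v \<in> places \<iota>" and B: "residue_basis \<iota> v B"
  shows "place_degree \<iota> v = card B"
  unfolding place_degree_def
proof (rule the_equality)
  show "\<exists>B'. residue_basis \<iota> v B' \<and> card B' = card B"
    using B by blast
  have le: "card B1 \<le> card B2" if B1: "residue_basis \<iota> v B1" and B2: "residue_basis \<iota> v B2" for B1 B2
  proof -
    note 1 = residue_basis_span[OF v B1] and 2 = residue_basis_span[OF v B2]
    obtain r where r: "\<And>x. x \<in> vs.span B1 \<Longrightarrow> r x \<in> vs.span B2 \<and> val_ge v 1 (x - r x)"
      using 1(3) 2(5) by metis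
    have "inj_on r (vs.span B1)"
    proof (rule inj_onI)
      fix x y assume xy: "x \<in> vs.span B1" "y \<in> vs.span B1" "r x = r y"
      have "val_ge v 1 ((x - r x) - (y - r y))"
        using r xy by (metis val_ge_diff[OF v])
      then have "x - y = 0"
        using xy by (intro 1(4)) (auto intro: vs.span_diff)
      then show "x = y" by simp
    qed
    then have "card (vs.span B1) \<le> card (vs.span B2)"
      using r 2(1) by (intro card_inj_on_le[of r]) auto
    then show ?thesis
      using 1(2) 2(2) card_constants_gt_1 by simp
  qed
  show "n = card B" if "\<exists>B'. residue_basis \<iota> v B' \<and> card B' = n" for n
    using that le[OF B] le[OF _ B] by (metis order_antisym)
qed

lemma residue_transversal:
  assumes v: "v \<in> places \<iota>"
  obtains T where "vs.subspace T" "finite T" "card T = CARD('k) ^ place_degree \<iota> v"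
    "\<And>x. x \<in> T \<Longrightarrow> val_ge v 0 x" "\<And>x. \<lbrakk>x \<in> T; val_ge v 1 x\<rbrakk> \<Longrightarrow> x = 0"
    "\<And>x. val_ge v 0 x \<Longrightarrow> \<exists>\<tau>\<in>T. val_ge v 1 (x - \<tau>)"
proof -
  obtain B where B: "residue_basis \<iota> v B"
    using residue_basis_exists[OF v] .
  show thesis
    using that[of "vs.span B"] residue_basis_span[OF v B] place_degree_eq_card[OF v B] by simp
qed

lemma place_degree_pos:
  assumes v: "v \<in> places \<iota>"
  shows "place_degree \<iota> v > 0"
proof (rule ccontr)
  assume "\<not> place_degree \<iota> v > 0"
  moreover obtain T where T: "vs.subspace T" "card T = CARD('k) ^ place_degree \<iota> v"
    "\<And>x. val_ge v 0 x \<Longrightarrow> \<exists>\<tau>\<in>T. val_ge v 1 (x - \<tau>)"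
    using residue_transversal[OF v] by metis
  ultimately have "card T = 1" by simp
  then have "T = {0}"
    using vs.subspace_0[OF T(1)] by (auto simp: card_1_singleton_iff)
  then have "val_ge v 1 (1 - 0)"
    using T(3)[of 1] by (auto simp: val_ge_def place_one[OF v])
  then show False
    by (simp add: val_ge_def place_one[OF v])
qed

end

section \<open>Weak approximation and finiteness of zeros\<close>

context function_field
begin

text \<open>If the valuation ring of \<open>v\<close> were contained in that of \<open>w\<close>,
  units of \<open>v\<close> would be units of \<open>w\<close>, so \<open>w\<close> would be
  \<open>w t\<close> times \<open>v\<close>. As \<open>w\<close> takes the value 1 and
  \<open>w t\<close> is nonnegative, the factor is 1.\<close>

lemma places_separate:
  assumes v: "v \<in> places \<iota>" and w: "w \<in> places \<iota>" and "v \<noteq> w"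
  shows "\<exists>y. y \<noteq> 0 \<and> v y \<ge> 0 \<and> w y < 0"
proof (rule ccontr)
  assume no: "\<nexists>y. y \<noteq> 0 \<and> v y \<ge> 0 \<and> w y < 0"
  then have le: "w y \<ge> 0" if "y \<noteq> 0" "v y \<ge> 0" for y
    using that by force
  have zero: "w y = 0" if "y \<noteq> 0" "v y = 0" for y
    using le[of y] le[of "inverse y"] that by (simp add: place_inverse[OF v] place_inverse[OF w])
  obtain t where t: "t \<noteq> 0" "v t = 1"
    by (rule place_uniformizer[OF v])
  have eq: "w y = v y * w t" if y: "y \<noteq> 0" for y
  proof (cases "v y \<ge> 0")
    case True
    have "v (y * inverse (t ^ nat (v y))) = 0"
      using t y True by (simp add: place_mult[OF v] place_inverse[OF v] place_power[OF v])
    then have "w (y * inverse (t ^ nat (v y))) = 0"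
      using t y by (intro zero) auto
    then show ?thesis
      using t y True by (simp add: place_mult[OF w] place_inverse[OF w] place_power[OF w])
  next
    case False
    have "v (y * t ^ nat (- v y)) = 0"
      using t y False by (simp add: place_mult[OF v] place_power[OF v])
    then have "w (y * t ^ nat (- v y)) = 0"
      using t y by (intro zero) auto
    then show ?thesis
      using t y False by (simp add: place_mult[OF w] place_power[OF w])
  qed
  obtain s where s: "s \<noteq> 0" "w s = 1"
    by (rule place_uniformizer[OF w])
  have "w t = 1"
    using eq[OF s(1)] s(2) le[OF t(1)] t(2) by (metis zmult_eq_1_iff zero_le_one not_one_le_zero
        minus_equation_iff neg_0_le_iff_le)
  moreover have "v 0 = 0" "w 0 = 0"
    using v w by (auto simp: places_def)
  ultimately have "v = w"
    using eq by (metis ext mult.right_neutral)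
  then show False
    using \<open>v \<noteq> w\<close> by simp
qed

lemma places_separate_strict:
  assumes v: "v \<in> places \<iota>" and w: "w \<in> places \<iota>" and "v \<noteq> w"
  obtains z where "z \<noteq> 0" "v z > 0" "w z < 0"
proof -
  obtain y where y: "y \<noteq> 0" "v y \<ge> 0" "w y < 0"
    using places_separate[OF v w] assms(3) by blast
  obtain y' where y': "y' \<noteq> 0" "w y' \<ge> 0" "v y' < 0"
    using places_separate[OF w v] assms(3) by blast
  show thesis
    using that[of "y * inverse y'"] y y'
    by (simp add: place_mult[OF v] place_inverse[OF v] place_mult[OF w] place_inverse[OF w])
qed

text \<open>The element is \<open>y + z ^ r\<close>: at places where \<open>z\<close> has a pole the
  power dominates, at the others \<open>y\<close> has a pole and dominates.\<close>

lemma places_separate_finite: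
  assumes "finite S" and "S \<subseteq> places \<iota>" and v: "v \<in> places \<iota>" and "v \<notin> S"
  shows "\<exists>z. z \<noteq> 0 \<and> v z > 0 \<and> (\<forall>w\<in>S. w z < 0)"
  using assms(1,2,4)
proof (induction S rule: finite_induct)
  case empty
  show ?case
    using place_uniformizer[OF v] by (metis empty_iff zero_less_one)
next
  case (insert Q S)
  obtain y where y: "y \<noteq> 0" "v y > 0" "\<And>w. w \<in> S \<Longrightarrow> w y < 0"
    using insert by auto
  obtain z where z: "z \<noteq> 0" "v z > 0" "Q z < 0"
    using places_separate_strict[OF v, of Q] insert.prems by auto
  \<comment> \<open>Exceeding every \<open>\<bar>w y\<bar>\<close> makes the pole of
    \<open>z ^ r\<close> strictly larger than that of \<open>y\<close>, which excludes
    cancellation.\<close>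
  define r where "r = Suc (\<Sum>w\<in>insert Q S. nat \<bar>w y\<bar>)"
  define u where "u = y + z ^ r"
  have neg: "u \<noteq> 0 \<and> w u < 0" if w: "w \<in> insert Q S" for w
  proof -
    have wp: "w \<in> places \<iota>"
      using w insert.prems by auto
    have wz: "w (z ^ r) = int r * w z" "z ^ r \<noteq> 0"
      using z place_power[OF wp] by auto
    have "nat \<bar>w y\<bar> \<le> (\<Sum>w\<in>insert Q S. nat \<bar>w y\<bar>)"
      using w insert.hyps by (intro member_le_sum) auto
    then have r: "\<bar>w y\<bar> < int r"
      unfolding r_def by linarith
    consider "w z < 0" | "w z = 0" "w y < 0" | "w z > 0" "w y < 0"
      using w z y by fastforce
    then show ?thesis
    proof cases
      case 1
      have "int r * w z \<le> int r * (- 1)"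
        using 1 by (intro mult_left_mono) auto
      then have "w (z ^ r) < w y" "w (z ^ r) < 0"
        using r wz by linarith+
      then show ?thesis
        using place_add_eq[OF wp wz(2), of y] by (auto simp: val_ge_def u_def add.commute)
    next
      case 2
      then show ?thesis
        using place_add_eq[OF wp y(1), of "z ^ r"] wz by (auto simp: val_ge_def u_def)
    next
      case 3
      then have "w (z ^ r) \<ge> 0"
        using wz by simp
      then show ?thesis
        using place_add_eq[OF wp y(1), of "z ^ r"] 3 by (auto simp: val_ge_def u_def)
    qed
  qed
  have "1 * 1 \<le> int r * v z"
    using z by (intro mult_mono) (auto simp: r_def)
  then have "v (z ^ r) \<ge> 1"
    by (simp add: place_power[OF v z(1)])
  then have "val_ge v 1 u"
    unfolding u_def using y z by (intro val_ge_add[OF v]) (auto simp: val_ge_def)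
  then show ?case
    using neg by (intro exI[of _ u]) (auto simp: val_ge_def)
qed

text \<open>With \<open>z\<close> from \<open>places_separate_finite\<close>,
  \<open>inverse (1 + z)\<close> is close to 1 where \<open>z\<close> vanishes and close to 0 where
  \<open>z\<close> has a pole.\<close>

lemma weak_approximation:
  assumes "finite S" and "S \<subseteq> places \<iota>" and v: "v \<in> places \<iota>" and "v \<notin> S"
  obtains u where "val_ge v 1 (u - 1)" "\<And>w. w \<in> S \<Longrightarrow> val_ge w 1 u"
proof -
  obtain z where z: "z \<noteq> 0" "v z > 0" "\<And>w. w \<in> S \<Longrightarrow> w z < 0"
    using places_separate_finite[OF assms] by blast
  have 1: "1 + z \<noteq> 0 \<and> v (1 + z) = 0"
    using place_add_eq[OF v, of 1 z] z by (auto simp: val_ge_def place_one[OF v])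
  have "inverse (1 + z) - 1 = - z / (1 + z)"
    using 1 by (simp add: field_simps)
  moreover have "val_ge v 1 (- z / (1 + z))"
    using 1 z val_ge_diff[OF v, of 1 0 z] val_ge_divide_iff[OF v, of "1 + z" 1 "- z"]
    by (simp add: val_ge_def)
  ultimately have "val_ge v 1 (inverse (1 + z) - 1)" by simp
  moreover have "val_ge w 1 (inverse (1 + z))" if "w \<in> S" for w
  proof -
    have w: "w \<in> places \<iota>"
      using that assms(2) by blast
    have "w (z + 1) = w z"
      using place_add_eq[OF w z(1), of 1] z(3)[OF that] by (auto simp: val_ge_def place_one[OF w])
    then show ?thesis
      using z(3)[OF that] by (simp add: val_ge_def place_inverse[OF w] add.commute)
  qed
  ultimately show thesis
    using that by blast
qed

end

context finite_function_field
begin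

text \<open>\<open>T\<close> is as large as the quotient of the ring of elements integral on
  \<open>S\<close> by the ideal of order at least \<open>D\<close>, and meets that ideal only in 0.
  The induction lowers \<open>D\<close> by 1 at one place \<open>P\<close> and then adjoins
  \<open>k U\<close>, where \<open>U\<close> represents the residue field at \<open>P\<close> and
  \<open>k\<close> has order exactly \<open>D P - 1\<close> there.\<close>

lemma semilocal_transversal:
  assumes "finite S" and "S \<subseteq> places \<iota>"
  shows "\<exists>T. vs.subspace T \<and> finite T \<and> (\<forall>x\<in>T. \<forall>w\<in>S. val_ge w 0 x) \<and>
    (\<forall>x\<in>T. (\<forall>w\<in>S. val_ge w (int (D w)) x) \<longrightarrow> x = 0) \<and>
    card T = CARD('k) ^ (\<Sum>w\<in>S. D w * place_degree \<iota> w)"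
proof (induction "\<Sum>w\<in>S. D w" arbitrary: D rule: less_induct)
  case less
  show ?case
  proof (cases "\<forall>w\<in>S. D w = 0")
    case True
    then show ?thesis
      by (intro exI[of _ "{0}"]) (auto intro!: vs.subspaceI)
  next
    case False
    then obtain P where P: "P \<in> S" "D P > 0" by auto
    then have Pp: "P \<in> places \<iota>"
      using assms by blast
    define D' where "D' = D(P := D P - 1)"
    have D'_le: "D' w \<le> D w" for w
      by (simp add: D'_def)
    \<comment> \<open>The weight \<open>g\<close> is left open: weight 1 gives the induction
      measure, the place degrees give the exponent of the cardinality.\<close>
    have sum_eq: "(\<Sum>w\<in>S. D w * g w) = (\<Sum>w\<in>S. D' w * g w) + g P" for g :: "('a \<Rightarrow> int) \<Rightarrow> nat"
    proof -
      have "(\<Sum>w\<in>S. D w * g w) = D P * g P + (\<Sum>w\<in>S - {P}. D w * g w)"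
        using P assms(1) by (simp add: sum.remove)
      also have "(\<Sum>w\<in>S - {P}. D w * g w) = (\<Sum>w\<in>S - {P}. D' w * g w)"
        by (rule sum.cong) (auto simp: D'_def)
      also have "D P * g P = D' P * g P + g P"
        using P(2) by (cases "D P") (auto simp: D'_def)
      finally show ?thesis
        using P assms(1) by (simp add: sum.remove)
    qed
    have "sum D' S < sum D S"
      using sum_eq[of "\<lambda>_. 1"] by simp
    from less[OF this] obtain T where T: "vs.subspace T" "finite T"
      and T0: "\<And>x w. \<lbrakk>x \<in> T; w \<in> S\<rbrakk> \<Longrightarrow> val_ge w 0 x"
      and TD: "\<And>x. \<lbrakk>x \<in> T; \<And>w. w \<in> S \<Longrightarrow> val_ge w (int (D' w)) x\<rbrakk> \<Longrightarrow> x = 0"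
      and cT: "card T = CARD('k) ^ (\<Sum>w\<in>S. D' w * place_degree \<iota> w)"
      by blast
    obtain U where U: "vs.subspace U" "finite U" "card U = CARD('k) ^ place_degree \<iota> P"
      and U0: "\<And>x. x \<in> U \<Longrightarrow> val_ge P 0 x" and U1: "\<And>x. \<lbrakk>x \<in> U; val_ge P 1 x\<rbrakk> \<Longrightarrow> x = 0"
      using residue_transversal[OF Pp] by metis
    obtain h where h: "h \<noteq> 0" "P h = int (D' P)"
      using exists_place_eq[OF Pp] .
    obtain u where u: "val_ge P 1 (u - 1)" "\<And>w. w \<in> S - {P} \<Longrightarrow> val_ge w 1 u"
      using weak_approximation[of "S - {P}" P] assms Pp by auto
    have u_P: "u \<noteq> 0" "P u = 0"
      using place_add_eq[OF Pp, of 1 "u - 1"] u(1) by (auto simp: place_one[OF Pp])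
    \<comment> \<open>\<open>bd\<close> is the power of \<open>u\<close> needed for
      \<open>k * \<tau>\<close> to have order at least \<open>D' w\<close> at \<open>w\<close>;
      \<open>N\<close> bounds it on the finite set of all pairs. High powers of \<open>u\<close> do
      not change the order at \<open>P\<close>, where \<open>u\<close> is a unit.\<close>
    define bd where "bd = (\<lambda>(w, \<tau>). nat (int (D' w) - w h - w \<tau>))"
    have "finite (bd ` (S \<times> U))"
      using assms(1) U(2) by simp
    then obtain N where N: "\<And>w \<tau>. w \<in> S \<Longrightarrow> \<tau> \<in> U \<Longrightarrow> bd (w, \<tau>) \<le> N"
      unfolding finite_nat_set_iff_bounded_le by blast
    define k where "k = h * u ^ N"
    have k: "k \<noteq> 0" "P k = int (D' P)"
      using h u_P by (auto simp: k_def place_mult[OF Pp] place_power[OF Pp])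
    have kU: "val_ge w (int (D' w)) (k * \<tau>)" if w: "w \<in> S" and \<tau>: "\<tau> \<in> U" for w \<tau>
    proof (cases "w = P")
      case True
      then show ?thesis
        using U0[OF \<tau>] k by (simp add: val_ge_mult_iff[OF Pp])
    next
      case False
      have wp: "w \<in> places \<iota>"
        using w assms by blast
      have "val_ge w (int N * 1) (u ^ N)"
        using False w u by (intro val_ge_power[OF wp]) auto
      moreover have "int (D' w) - w h - w \<tau> \<le> int N"
        using N[OF w \<tau>] by (simp add: bd_def)
      moreover have "k * \<tau> = h * (u ^ N * \<tau>)"
        by (simp add: k_def)
      ultimately show ?thesis
        using h(1) u_P(1) by (cases "\<tau> = 0") (auto simp: val_ge_def place_mult[OF wp])
    qed
    define T' where "T' = {x + y | x y. x \<in> T \<and> y \<in> (*) k ` U}"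
    have kU_sub: "vs.subspace ((*) k ` U)"
    proof (rule vs.subspaceI)
      show "0 \<in> (*) k ` U"
        using vs.subspace_0[OF U(1)] by force
      show "x + y \<in> (*) k ` U" if "x \<in> (*) k ` U" "y \<in> (*) k ` U" for x y
        using that vs.subspace_add[OF U(1)] by (auto simp flip: distrib_left)
      show "\<iota> c * x \<in> (*) k ` U" if "x \<in> (*) k ` U" for c x
        using that vs.subspace_scale[OF U(1)] by (auto simp: mult.left_commute[of "\<iota> c" k])
    qed
    have "vs.subspace T'"
      unfolding T'_def by (rule vs.subspace_sums[OF T(1) kU_sub])
    moreover have T'_eq: "T' = (\<lambda>(x, \<tau>). x + k * \<tau>) ` (T \<times> U)"
      unfolding T'_def by auto
    then have "finite T'"
      using T U by simp
    moreover have "val_ge w 0 x" if "x \<in> T'" and w: "w \<in> S" for x w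
    proof -
      have wp: "w \<in> places \<iota>"
        using w assms by blast
      have "val_ge w 0 (k * \<tau>)" if "\<tau> \<in> U" for \<tau>
        using kU[OF w that] by (rule val_ge_mono) simp
      then show ?thesis
        using \<open>x \<in> T'\<close> T0 w by (auto simp: T'_eq intro!: val_ge_add[OF wp])
    qed
    moreover have "x = 0" if x: "x \<in> T'" and ge: "\<And>w. w \<in> S \<Longrightarrow> val_ge w (int (D w)) x" for x
    proof -
      obtain y \<tau> where y: "x = y + k * \<tau>" "y \<in> T" "\<tau> \<in> U"
        using x by (auto simp: T'_eq)
      \<comment> \<open>As \<open>k * \<tau>\<close> has order at least \<open>D'\<close> everywhere
        on \<open>S\<close>, so has \<open>y\<close>. What is left is \<open>k * \<tau>\<close>,
        whose order at \<open>P\<close> now forces \<open>\<tau>\<close> into the maximal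
        ideal.\<close>
      have "y = 0"
      proof (rule TD[OF y(2)])
        fix w assume w: "w \<in> S"
        then have wp: "w \<in> places \<iota>"
          using assms by blast
        have "val_ge w (int (D' w)) (x - k * \<tau>)"
          using kU[OF w y(3)] val_ge_mono[OF ge[OF w]] D'_le by (intro val_ge_diff[OF wp]) auto
        then show "val_ge w (int (D' w)) y"
          by (simp add: y(1))
      qed
      then have "val_ge P (int (D P)) (k * \<tau>)"
        using ge[OF P(1)] y by simp
      then have "val_ge P 1 \<tau>"
        using k P(2) by (simp add: val_ge_mult_iff[OF Pp] D'_def)
      then show ?thesis
        using U1 y \<open>y = 0\<close> by simp
    qed
    moreover have "card T' = CARD('k) ^ (\<Sum>w\<in>S. D w * place_degree \<iota> w)"
    proof -
      have "inj_on (\<lambda>(x, \<tau>). x + k * \<tau>) (T \<times> U)"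
      proof (rule inj_onI, clarify)
        fix x \<tau> x' \<tau>'
        assume mem: "x \<in> T" "\<tau> \<in> U" "x' \<in> T" "\<tau>' \<in> U" and eq: "x + k * \<tau> = x' + k * \<tau>'"
        have "x - x' = k * (\<tau>' - \<tau>)"
          using eq by (simp add: algebra_simps)
        moreover have "\<tau>' - \<tau> \<in> U" "x - x' \<in> T"
          using mem T U by (auto intro: vs.subspace_diff)
        ultimately have "x - x' = 0"
          using kU by (intro TD) auto
        then show "x = x' \<and> \<tau> = \<tau>'"
          using eq k by simp
      qed
      then have "card T' = card T * card U"
        by (simp add: T'_eq card_image card_cartesian_product)
      then show ?thesis
        by (simp add: cT U(3) sum_eq power_add)
    qed
    ultimately show ?thesis by blast
  qed
qed

text \<open>Let \<open>H\<close> be the ring of elements integral on \<open>S\<close>. All of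
  \<open>y H\<close> has order at least \<open>w y\<close> at each \<open>w\<close>, so a
  transversal for these orders meets it only in 0.\<close>

lemma free_subspace_from_zeros:
  assumes "finite S" and "S \<subseteq> places \<iota>" and "y \<noteq> 0" and pos: "\<And>w. w \<in> S \<Longrightarrow> w y > 0"
  obtains T where "vs.subspace T" "finite T" "free_over y T"
    "card T = CARD('k) ^ (\<Sum>w\<in>S. nat (w y) * place_degree \<iota> w)"
proof -
  obtain T where T: "vs.subspace T" "finite T"
    and T0: "\<And>x w. \<lbrakk>x \<in> T; w \<in> S\<rbrakk> \<Longrightarrow> val_ge w 0 x"
    and TD: "\<And>x. \<lbrakk>x \<in> T; \<And>w. w \<in> S \<Longrightarrow> val_ge w (int (nat (w y))) x\<rbrakk> \<Longrightarrow> x = 0"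
    and cT: "card T = CARD('k) ^ (\<Sum>w\<in>S. nat (w y) * place_degree \<iota> w)"
    using semilocal_transversal[OF assms(1,2), of "\<lambda>w. nat (w y)"] by blast
  have "free_over y T"
  proof (rule free_over_if_disjoint)
    show "T \<subseteq> {x. \<forall>w\<in>S. val_ge w 0 x}"
      using T0 by blast
    show "vs.subspace {x. \<forall>w\<in>S. val_ge w 0 x}"
      using assms(2) by (intro vs.subspaceI) (auto intro: val_ge_add val_ge_scale)
    have y: "val_ge w (int (nat (w y))) (y * h)" if "w \<in> S" "val_ge w 0 h" for w h
      using that pos[OF that(1)] assms(2,3) by (subst val_ge_mult_iff) auto
    show "y * h \<in> {x. \<forall>w\<in>S. val_ge w 0 x}" if "h \<in> {x. \<forall>w\<in>S. val_ge w 0 x}" for h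
      using that y by (auto intro!: val_ge_mono[OF y])
    show "y * h = 0" if "h \<in> {x. \<forall>w\<in>S. val_ge w 0 x}" "y * h \<in> T" for h
      using that y TD by blast
  qed fact
  then show thesis
    using that T cT by blast
qed

text \<open>Each zero contributes at least one dimension to a free subspace, whose dimension is
  bounded.\<close>

lemma finite_zeros:
  assumes "y \<noteq> 0"
  shows "finite {v \<in> places \<iota>. v y > 0}"
proof -
  obtain M where M: "\<And>T. \<lbrakk>vs.subspace T; finite T; free_over y T\<rbrakk> \<Longrightarrow> card T \<le> CARD('k) ^ M"
    using card_free_over_bounded[of y] by blast
  have "card S \<le> M" if S: "S \<subseteq> {v \<in> places \<iota>. v y > 0}" "finite S" for S
  proof -
    obtain T where "vs.subspace T" "finite T" "free_over y T"
      and "card T = CARD('k) ^ (\<Sum>w\<in>S. nat (w y) * place_degree \<iota> w)"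
      using free_subspace_from_zeros[OF S(2) _ assms] S(1) by blast
    then have "CARD('k) ^ (\<Sum>w\<in>S. nat (w y) * place_degree \<iota> w) \<le> CARD('k) ^ M"
      using M by metis
    then have "(\<Sum>w\<in>S. nat (w y) * place_degree \<iota> w) \<le> M"
      using card_constants_gt_1 by simp
    moreover have "(\<Sum>w\<in>S. 1) \<le> (\<Sum>w\<in>S. nat (w y) * place_degree \<iota> w)"
    proof (rule sum_mono)
      fix w assume "w \<in> S"
      then have "nat (w y) > 0" "place_degree \<iota> w > 0"
        using S(1) place_degree_pos by auto
      then show "1 \<le> nat (w y) * place_degree \<iota> w"
        by (simp add: Suc_leI)
    qed
    ultimately show ?thesis by simp
  qed
  then show ?thesis
    using finite_if_finite_subsets_card_bdd by blast
qed

end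

section \<open>Divisors and Riemann--Roch spaces\<close>

abbreviation (input) "coef \<equiv> Poly_Mapping.lookup"

context function_field
begin

lemma divisors_iff: "D \<in> divisors \<iota> \<longleftrightarrow> (\<forall>v. v \<notin> places \<iota> \<longrightarrow> coef D v = 0)"
  by (auto simp: divisors_def in_keys_iff)

lemma divisors_zero [simp]: "0 \<in> divisors \<iota>"
  and divisors_add [simp]: "\<lbrakk>D \<in> divisors \<iota>; E \<in> divisors \<iota>\<rbrakk> \<Longrightarrow> D + E \<in> divisors \<iota>"
  and divisors_diff [simp]: "\<lbrakk>D \<in> divisors \<iota>; E \<in> divisors \<iota>\<rbrakk> \<Longrightarrow> D - E \<in> divisors \<iota>"
  and divisors_uminus [simp]: "D \<in> divisors \<iota> \<Longrightarrow> - D \<in> divisors \<iota>"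
  and divisors_single [simp]: "v \<in> places \<iota> \<Longrightarrow> Poly_Mapping.single v n \<in> divisors \<iota>"
  by (auto simp: divisors_iff lookup_add lookup_minus lookup_single when_def)

lemma divisor_eqI:
  "\<lbrakk>D \<in> divisors \<iota>; E \<in> divisors \<iota>; \<And>v. v \<in> places \<iota> \<Longrightarrow> coef D v = coef E v\<rbrakk> \<Longrightarrow> D = E"
  by (intro poly_mapping_eqI) (metis divisors_iff)

lemma exists_divisor:
  assumes "finite {v \<in> places \<iota>. f v \<noteq> (0 :: int)}"
  obtains D where "D \<in> divisors \<iota>" "\<And>v. v \<in> places \<iota> \<Longrightarrow> coef D v = f v"
proof -
  define g where "g v = (if v \<in> places \<iota> then f v else 0)" for v
  have "{v. g v \<noteq> 0} = {v \<in> places \<iota>. f v \<noteq> 0}"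
    by (auto simp: g_def)
  then have "coef (Abs_poly_mapping g) = g"
    using assms by simp
  then show thesis
    using that[of "Abs_poly_mapping g"] by (simp add: divisors_iff g_def)
qed

lemma div_degree_eq:
  assumes "finite S" and "Poly_Mapping.keys D \<subseteq> S"
  shows "div_degree \<iota> D = (\<Sum>v\<in>S. coef D v * int (place_degree \<iota> v))"
  unfolding div_degree_def using assms
  by (intro sum.mono_neutral_left) (auto simp: in_keys_iff)

lemma div_degree_add: "div_degree \<iota> (D + E) = div_degree \<iota> D + div_degree \<iota> E"
proof -
  let ?S = "Poly_Mapping.keys D \<union> Poly_Mapping.keys E"
  have "div_degree \<iota> (D + E) = (\<Sum>v\<in>?S. coef (D + E) v * int (place_degree \<iota> v))"
    by (rule div_degree_eq) (auto simp: in_keys_iff lookup_add)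
  then show ?thesis
    by (simp add: div_degree_eq[of ?S D] div_degree_eq[of ?S E] lookup_add distrib_right sum.distrib)
qed

lemma div_degree_zero [simp]: "div_degree \<iota> 0 = 0"
  by (simp add: div_degree_def)

lemma div_degree_uminus: "div_degree \<iota> (- D) = - div_degree \<iota> D"
  using div_degree_add[of D "- D"] by simp

lemma div_degree_diff: "div_degree \<iota> (D - E) = div_degree \<iota> D - div_degree \<iota> E"
  using div_degree_add[of D "- E"] by (simp add: div_degree_uminus)

lemma div_degree_single: "div_degree \<iota> (Poly_Mapping.single v n) = n * int (place_degree \<iota> v)"
  by (subst div_degree_eq[of "{v}"]) auto

definition div_scale :: "int \<Rightarrow> 'a divisor \<Rightarrow> 'a divisor" where
  "div_scale n D = Poly_Mapping.map ((*) n) D"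

lemma lookup_div_scale [simp]: "coef (div_scale n D) v = n * coef D v"
  by (simp add: div_scale_def map.rep_eq when_def)

lemma div_degree_scale: "div_degree \<iota> (div_scale n D) = n * div_degree \<iota> D"
proof -
  have "div_degree \<iota> (div_scale n D) = (\<Sum>v\<in>Poly_Mapping.keys D. coef (div_scale n D) v * int (place_degree \<iota> v))"
    by (rule div_degree_eq) (auto simp: in_keys_iff)
  then show ?thesis
    by (simp add: div_degree_def sum_distrib_left mult.assoc)
qed

lemma divisors_scale [simp]: "D \<in> divisors \<iota> \<Longrightarrow> div_scale n D \<in> divisors \<iota>"
  by (simp add: divisors_iff)

definition div_le :: "'a divisor \<Rightarrow> 'a divisor \<Rightarrow> bool" where
  "div_le D E \<longleftrightarrow> (\<forall>v\<in>places \<iota>. coef D v \<le> coef E v)"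

text \<open>Reduces comparisons between \<open>D\<close> and a larger divisor to the addition of one
  place; the measure is the number of places in \<open>E - D\<close> counted with
  multiplicity.\<close>

lemma div_le_induct [consumes 3, case_names refl step]:
  assumes "D \<in> divisors \<iota>" and "E \<in> divisors \<iota>" and "div_le D E"
    and "Q D"
    and step: "\<And>F v. \<lbrakk>F \<in> divisors \<iota>; div_le D F; v \<in> places \<iota>; Q F\<rbrakk> \<Longrightarrow> Q (F + Poly_Mapping.single v 1)"
  shows "Q E"
  using assms(2,3)
proof (induction "\<Sum>v\<in>Poly_Mapping.keys (E - D). nat (coef (E - D) v)" arbitrary: E rule: less_induct)
  case less
  show ?case
  proof (cases "E = D")
    case False
    then obtain w where w: "w \<in> places \<iota>" "coef E w \<noteq> coef D w"
      using divisor_eqI[OF less.prems(1) assms(1)] by blast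
    then have lt: "coef D w < coef E w"
      using less.prems(2) by (auto simp: div_le_def order_less_le)
    define F where "F = E - Poly_Mapping.single w 1"
    have F: "F \<in> divisors \<iota>" "div_le D F"
      using less.prems lt w by (auto simp: F_def div_le_def lookup_minus lookup_single when_def)
    let ?S = "Poly_Mapping.keys (E - D)"
    have wS: "w \<in> ?S"
      using w by (simp add: in_keys_iff lookup_minus)
    have "Poly_Mapping.keys (F - D) \<subseteq> ?S"
      using lt by (auto simp: in_keys_iff F_def lookup_minus lookup_single when_def split: if_splits)
    then have "(\<Sum>v\<in>Poly_Mapping.keys (F - D). nat (coef (F - D) v)) = (\<Sum>v\<in>?S. nat (coef (F - D) v))"
      by (intro sum.mono_neutral_left) (auto simp: in_keys_iff)
    also have "\<dots> < (\<Sum>v\<in>?S. nat (coef (E - D) v))"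
    proof (rule sum_strict_mono_ex1)
      show "\<forall>v\<in>?S. nat (coef (F - D) v) \<le> nat (coef (E - D) v)"
        by (auto simp: F_def lookup_minus lookup_single when_def)
      show "\<exists>v\<in>?S. nat (coef (F - D) v) < nat (coef (E - D) v)"
        using wS lt by (auto simp: F_def lookup_minus lookup_single intro!: bexI[of _ w])
    qed simp
    finally have "Q F"
      using less.hyps F by blast
    then show ?thesis
      using step[OF F w(1)] by (simp add: F_def)
  qed (use assms in simp)
qed

lemma LL_iff: "f \<in> LL \<iota> D \<longleftrightarrow> (\<forall>v\<in>places \<iota>. val_ge v (- coef D v) f)"
  by (auto simp: LL_def val_ge_def)

lemma LL_zero [simp]: "0 \<in> LL \<iota> D"
  by (simp add: LL_def)

lemma LL_subspace: "vs.subspace (LL \<iota> D)"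
  by (intro vs.subspaceI) (auto simp: LL_iff intro: val_ge_add val_ge_scale)

lemma LL_mono: "div_le D E \<Longrightarrow> LL \<iota> D \<subseteq> LL \<iota> E"
  unfolding LL_iff div_le_def subset_iff by (meson val_ge_mono neg_le_iff_le)

lemma LL_mult: "\<lbrakk>f \<in> LL \<iota> D; g \<in> LL \<iota> E\<rbrakk> \<Longrightarrow> f * g \<in> LL \<iota> (D + E)"
  unfolding LL_iff lookup_add by (metis val_ge_mult add.inverse_distrib_swap add.commute)

lemma LL_mult_principal:
  assumes "is_divisor_of \<iota> h (D - E)"
  shows "f * h \<in> LL \<iota> E \<longleftrightarrow> f \<in> LL \<iota> D"
proof -
  have "val_ge v (- coef E v) (h * f) \<longleftrightarrow> val_ge v (- coef D v) f" if v: "v \<in> places \<iota>" for v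
  proof -
    have "h \<noteq> 0" "- coef E v - v h = - coef D v"
      using assms v by (auto simp: is_divisor_of_def lookup_minus)
    then show ?thesis
      using val_ge_mult_iff[OF v, of h "- coef E v" f] by simp
  qed
  then show ?thesis
    by (simp add: LL_iff mult.commute)
qed

end

context finite_function_field
begin

section \<open>Finiteness and dimension of L(D)\<close>

lemma inverse_notin_constants: "f \<notin> range \<iota> \<Longrightarrow> inverse f \<notin> range \<iota>"
proof (rule notI, elim rangeE)
  fix c assume "f \<notin> range \<iota>" "inverse f = \<iota> c"
  then have "f = \<iota> (inverse c)"
    by (simp add: hom_inverse flip: \<open>inverse f = \<iota> c\<close>)
  then show False
    using \<open>f \<notin> range \<iota>\<close> by blast
qed

text \<open>A nonconstant \<open>f\<close> has a pole, namely a zero of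
  \<open>inverse f\<close>.\<close>

lemma LL_0: "LL \<iota> 0 = range \<iota>"
proof
  show "LL \<iota> 0 \<subseteq> range \<iota>"
  proof
    fix f assume f: "f \<in> LL \<iota> 0"
    show "f \<in> range \<iota>"
    proof (rule ccontr)
      assume no: "f \<notin> range \<iota>"
      then have "inverse f \<notin> range \<iota>"
        by (rule inverse_notin_constants)
      then obtain v where v: "v \<in> places \<iota>" "v (inverse f) > 0"
        using exists_zero by blast
      then have "v f < 0"
        by (simp add: place_inverse)
      then show False
        using f v(1) no by (auto simp: LL_def)
    qed
  qed
  show "range \<iota> \<subseteq> LL \<iota> 0"
    by (auto simp: LL_iff val_ge_const)
qed

text \<open>After division by \<open>h\<close>, which has the extreme order at \<open>v\<close>, the
  residue class is the leading coefficient at \<open>v\<close>. Two functions with the same leading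
  coefficient differ by an element of L(D).\<close>

lemma LL_step:
  assumes v: "v \<in> places \<iota>" and fin: "finite (LL \<iota> D)"
  shows "finite (LL \<iota> (D + Poly_Mapping.single v 1)) \<and>
    card (LL \<iota> (D + Poly_Mapping.single v 1)) \<le> card (LL \<iota> D) * CARD('k) ^ place_degree \<iota> v"
proof -
  let ?D' = "D + Poly_Mapping.single v 1"
  obtain T where T: "finite T" "card T = CARD('k) ^ place_degree \<iota> v"
    and cover: "\<And>x. val_ge v 0 x \<Longrightarrow> \<exists>\<tau>\<in>T. val_ge v 1 (x - \<tau>)"
    using residue_transversal[OF v] by metis
  obtain h where h: "h \<noteq> 0" "v h = - coef ?D' v"
    using exists_place_eq[OF v] .
  have "\<exists>\<tau>\<in>T. val_ge v 1 (f / h - \<tau>)" if "f \<in> LL \<iota> ?D'" for f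
    using that h v by (intro cover) (auto simp: LL_iff val_ge_divide_iff)
  then obtain r where r: "\<And>f. f \<in> LL \<iota> ?D' \<Longrightarrow> r f \<in> T \<and> val_ge v 1 (f / h - r f)"
    by metis
  show ?thesis
    unfolding T(2)[symmetric]
  proof (rule card_le_card_fibres[OF fin T(1), of _ r])
    fix f g assume fg: "f \<in> LL \<iota> ?D'" "g \<in> LL \<iota> ?D'" "r f = r g"
    have "val_ge v 1 ((f / h - r f) - (g / h - r g))"
      using r fg by (metis val_ge_diff[OF v])
    then have "val_ge v 1 ((f - g) / h)"
      using fg(3) by (simp add: diff_divide_distrib)
    then have "val_ge v (- coef D v) (f - g)"
      using h by (simp add: val_ge_divide_iff[OF v] lookup_add)
    moreover have "val_ge w (- coef D w) (f - g)" if "w \<in> places \<iota>" "w \<noteq> v" for w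
      using vs.subspace_diff[OF LL_subspace fg(1,2)] that by (auto simp: LL_iff lookup_add lookup_single when_def)
    ultimately show "f - g \<in> LL \<iota> D"
      by (auto simp: LL_iff)
  qed (use r in auto)
qed

lemma finite_LL:
  assumes "D \<in> divisors \<iota>"
  shows "finite (LL \<iota> D)"
proof -
  \<comment> \<open>The positive part of \<open>D\<close> lies above both 0 and \<open>D\<close>, so
    the induction can start from the constants.\<close>
  obtain E where E: "E \<in> divisors \<iota>" "\<And>v. v \<in> places \<iota> \<Longrightarrow> coef E v = max 0 (coef D v)"
  proof (rule exists_divisor)
    show "finite {v \<in> places \<iota>. max 0 (coef D v) \<noteq> 0}"
      by (rule finite_subset[of _ "Poly_Mapping.keys D"]) (auto simp: in_keys_iff)
  qed blast
  have "div_le 0 E" "div_le D E"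
    using E by (auto simp: div_le_def)
  from divisors_zero E(1) this(1) have "finite (LL \<iota> E)"
  proof (induction rule: div_le_induct)
    case refl
    show ?case by (simp add: LL_0)
  qed (use LL_step in blast)
  then show ?thesis
    using LL_mono[OF \<open>div_le D E\<close>] finite_subset by blast
qed

lemma card_LL: "D \<in> divisors \<iota> \<Longrightarrow> card (LL \<iota> D) = CARD('k) ^ ell \<iota> D"
  unfolding ell_def by (intro card_subspace LL_subspace finite_LL)

lemma ell_le_iff:
  assumes "D \<in> divisors \<iota>" "E \<in> divisors \<iota>"
  shows "ell \<iota> D \<le> ell \<iota> E \<longleftrightarrow> card (LL \<iota> D) \<le> card (LL \<iota> E)"
  using card_constants_gt_1 by (simp add: card_LL assms)

lemma ell_0: "ell \<iota> 0 = 1"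
proof -
  have "card (range \<iota>) = CARD('k)"
    by (intro card_image) (auto simp: inj_on_def)
  then have "CARD('k) ^ ell \<iota> 0 = CARD('k) ^ 1"
    using card_LL[of 0] by (simp add: LL_0)
  then show ?thesis
    using card_constants_gt_1 power_inject_exp by blast
qed

lemma ell_mono:
  assumes "D \<in> divisors \<iota>" "E \<in> divisors \<iota>" "div_le D E"
  shows "ell \<iota> D \<le> ell \<iota> E"
  using assms by (simp add: ell_le_iff card_mono finite_LL LL_mono)

lemma ell_step:
  assumes "D \<in> divisors \<iota>" and "v \<in> places \<iota>"
  shows "ell \<iota> (D + Poly_Mapping.single v 1) \<le> ell \<iota> D + place_degree \<iota> v"
proof -
  have "CARD('k) ^ ell \<iota> (D + Poly_Mapping.single v 1) \<le> CARD('k) ^ (ell \<iota> D + place_degree \<iota> v)"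
    using LL_step[OF assms(2) finite_LL[OF assms(1)]] assms by (simp add: card_LL power_add)
  then show ?thesis
    using card_constants_gt_1 by simp
qed

lemma ell_diff_le:
  assumes "D \<in> divisors \<iota>" "E \<in> divisors \<iota>" "div_le D E"
  shows "int (ell \<iota> E) - int (ell \<iota> D) \<le> div_degree \<iota> E - div_degree \<iota> D"
  using assms
proof (induction rule: div_le_induct)
  case (step F v)
  then show ?case
    using ell_step[of F v] by (simp add: div_degree_add div_degree_single)
qed simp

lemma div_degree_nonneg:
  assumes "\<And>v. v \<in> places \<iota> \<Longrightarrow> coef D v \<ge> 0" and "D \<in> divisors \<iota>"
  shows "div_degree \<iota> D \<ge> 0"
  using assms by (auto simp: div_degree_def divisors_def intro!: sum_nonneg)

lemma div_degree_eq_0: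
  assumes nonneg: "\<And>v. v \<in> places \<iota> \<Longrightarrow> coef D v \<ge> 0" and D: "D \<in> divisors \<iota>"
    and "div_degree \<iota> D = 0"
  shows "D = 0"
proof -
  have sub: "Poly_Mapping.keys D \<subseteq> places \<iota>"
    using D by (simp add: divisors_def)
  have "coef D v * int (place_degree \<iota> v) = 0" if "v \<in> Poly_Mapping.keys D" for v
    using assms(3) that sub nonneg unfolding div_degree_def
    by (subst (asm) sum_nonneg_eq_0_iff) auto
  then have "Poly_Mapping.keys D = {}"
    using sub place_degree_pos by (fastforce simp: in_keys_iff)
  then show ?thesis by simp
qed

section \<open>The product formula and Riemann's inequality\<close>

lemma zero_divisor_exists:
  assumes "y \<noteq> 0"
  obtains D where "D \<in> divisors \<iota>" "\<And>v. v \<in> places \<iota> \<Longrightarrow> coef D v = max 0 (v y)"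
    "div_degree \<iota> D = int (\<Sum>v\<in>{v \<in> places \<iota>. v y > 0}. nat (v y) * place_degree \<iota> v)"
proof -
  have fin: "finite {v \<in> places \<iota>. v y > 0}"
    by (rule finite_zeros[OF assms])
  obtain D where D: "D \<in> divisors \<iota>" "\<And>v. v \<in> places \<iota> \<Longrightarrow> coef D v = max 0 (v y)"
  proof (rule exists_divisor)
    show "finite {v \<in> places \<iota>. max 0 (v y) \<noteq> 0}"
      using fin by (rule rev_finite_subset) auto
  qed blast
  moreover have "div_degree \<iota> D = int (\<Sum>v\<in>{v \<in> places \<iota>. v y > 0}. nat (v y) * place_degree \<iota> v)"
  proof -
    have "Poly_Mapping.keys D \<subseteq> {v \<in> places \<iota>. v y > 0}"
    proof
      fix v assume v: "v \<in> Poly_Mapping.keys D"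
      then have "v \<in> places \<iota>"
        using D(1) by (auto simp: divisors_def)
      then show "v \<in> {v \<in> places \<iota>. v y > 0}"
        using v D(2)[of v] by (auto simp: in_keys_iff max_def split: if_splits)
    qed
    then have "div_degree \<iota> D = (\<Sum>v\<in>{v \<in> places \<iota>. v y > 0}. coef D v * int (place_degree \<iota> v))"
      by (rule div_degree_eq[OF fin])
    also have "\<dots> = (\<Sum>v\<in>{v \<in> places \<iota>. v y > 0}. int (nat (v y) * place_degree \<iota> v))"
      by (rule sum.cong) (auto simp: D(2))
    finally show ?thesis by simp
  qed
  ultimately show thesis
    using that by blast
qed

lemma finite_set_in_LL:
  assumes "finite T"
  obtains C where "C \<in> divisors \<iota>" "\<And>v. v \<in> places \<iota> \<Longrightarrow> coef C v \<ge> 0" "T \<subseteq> LL \<iota> C"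
proof -
  have "finite {v \<in> places \<iota>. (\<Sum>t\<in>T. max 0 (- v t)) \<noteq> 0}"
  proof (rule finite_subset)
    show "{v \<in> places \<iota>. (\<Sum>t\<in>T. max 0 (- v t)) \<noteq> 0} \<subseteq>
        (\<Union>t\<in>T - {0}. {v \<in> places \<iota>. v (inverse t) > 0})"
    proof clarify
      fix v assume v: "v \<in> places \<iota>" "(\<Sum>t\<in>T. max 0 (- v t)) \<noteq> 0"
      then obtain t where t: "t \<in> T" "max 0 (- v t) \<noteq> 0"
        by (meson sum.neutral)
      \<comment> \<open>The dummy value \<open>v 0 = 0\<close> makes the summand of 0
        vanish.\<close>
      then have "t \<noteq> 0"
        using v(1) by (auto simp: places_def)
      then show "v \<in> (\<Union>t\<in>T - {0}. {v \<in> places \<iota>. v (inverse t) > 0})"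
        using t v by (intro UN_I[of t]) (auto simp: place_inverse max_def split: if_splits)
    qed
    show "finite (\<Union>t\<in>T - {0}. {v \<in> places \<iota>. v (inverse t) > 0})"
      using assms by (auto intro!: finite_zeros)
  qed
  then obtain C where C: "C \<in> divisors \<iota>" "\<And>v. v \<in> places \<iota> \<Longrightarrow> coef C v = (\<Sum>t\<in>T. max 0 (- v t))"
    by (rule exists_divisor) blast
  have "T \<subseteq> LL \<iota> C"
  proof
    fix t assume t: "t \<in> T"
    have "- coef C v \<le> v t" if v: "v \<in> places \<iota>" for v
      using member_le_sum[OF t, of "\<lambda>t. max 0 (- v t)"] assms C(2)[OF v] by fastforce
    then show "t \<in> LL \<iota> C"
      by (auto simp: LL_iff val_ge_def)
  qed
  then show thesis
    using that[OF C(1)] C(2) by (simp add: sum_nonneg)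
qed

text \<open>\<open>E\<close> is the pole divisor of \<open>y\<close>, so \<open>y ^ k\<close> costs
  at most \<open>k\<close> times \<open>E\<close>. The sums have \<open>Suc r\<close> terms because
  the highest exponent is \<open>r\<close>.\<close>

lemma psums_subset_LL:
  assumes T: "T \<subseteq> LL \<iota> C" and E: "\<And>v. v \<in> places \<iota> \<Longrightarrow> coef E v = max 0 (v (inverse y))"
  shows "psums y T (Suc r) \<subseteq> LL \<iota> (C + div_scale (int r) E)"
proof -
  have "val_ge v (- coef C v - int r * coef E v) (\<Sum>k<Suc r. y ^ k * t k)"
    if t: "t \<in> {..<Suc r} \<rightarrow>\<^sub>E T" and v: "v \<in> places \<iota>" for t v
  proof (rule val_ge_sum[OF v])
    fix k assume k: "k \<in> {..<Suc r}"
    have y: "val_ge v (- coef E v) y" and E0: "coef E v \<ge> 0"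
      by (auto simp: val_ge_def E[OF v] place_inverse[OF v])
    have "val_ge v (- coef C v) (t k)"
      using t k T v by (auto simp: LL_iff)
    then have "val_ge v (int k * (- coef E v) + - coef C v) (y ^ k * t k)"
      by (intro val_ge_mult[OF v] val_ge_power[OF v] y)
    moreover have "int k * coef E v \<le> int r * coef E v"
      using k E0 by (intro mult_right_mono) auto
    ultimately show "val_ge v (- coef C v - int r * coef E v) (y ^ k * t k)"
      by (auto elim: val_ge_mono)
  qed
  then show ?thesis
    by (auto simp: psums_def LL_iff lookup_add simp del: sum.lessThan_Suc)
qed

lemma card_free_over_le:
  assumes T: "vs.subspace T" "finite T" "free_over y T"
    and E: "E \<in> divisors \<iota>" "\<And>v. v \<in> places \<iota> \<Longrightarrow> coef E v = max 0 (v (inverse y))"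
  shows "card T \<le> CARD('k) ^ nat (div_degree \<iota> E)"
proof -
  obtain C where C: "C \<in> divisors \<iota>" "\<And>v. v \<in> places \<iota> \<Longrightarrow> coef C v \<ge> 0" "T \<subseteq> LL \<iota> C"
    using finite_set_in_LL[OF T(2)] by blast
  have deg: "div_degree \<iota> C \<ge> 0" "div_degree \<iota> E \<ge> 0"
    using C E by (auto intro!: div_degree_nonneg)
  show ?thesis
  proof (rule le_power_if_powers_le)
    show "card T ^ N \<le> CARD('k) ^ (nat (div_degree \<iota> E) * N + Suc (nat (div_degree \<iota> C)))" for N
    proof (cases N)
      case (Suc r)
      let ?A = "C + div_scale (int r) E"
      have A: "?A \<in> divisors \<iota>" "div_le 0 ?A"
        using C E by (auto simp: div_le_def lookup_add)
      have "card T ^ N = card (psums y T N)"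
        by (simp add: card_psums[OF T(1,3)])
      also have "\<dots> \<le> card (LL \<iota> ?A)"
        unfolding Suc using psums_subset_LL[OF C(3) E(2)] by (intro card_mono finite_LL A) auto
      also have "\<dots> = CARD('k) ^ ell \<iota> ?A"
        by (rule card_LL[OF A(1)])
      also have "\<dots> \<le> CARD('k) ^ (nat (div_degree \<iota> E) * N + Suc (nat (div_degree \<iota> C)))"
      proof (rule power_increasing)
        \<comment> \<open>Going up from the zero divisor to \<open>?A\<close> adds at most the
          degree; the 1 is the dimension of the constants.\<close>
        have "int (ell \<iota> ?A) \<le> 1 + (div_degree \<iota> C + int r * div_degree \<iota> E)"
          using ell_diff_le[OF divisors_zero A] by (simp add: ell_0 div_degree_add div_degree_scale)
        also have "\<dots> \<le> int (nat (div_degree \<iota> E) * N + Suc (nat (div_degree \<iota> C)))"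
          using deg by (simp add: Suc algebra_simps)
        finally show "ell \<iota> ?A \<le> nat (div_degree \<iota> E) * N + Suc (nat (div_degree \<iota> C))"
          by linarith
      qed (use card_constants_gt_1 in simp)
      finally show ?thesis .
    qed simp
  qed simp
qed

lemma degree_zeros_le_degree_poles:
  assumes y0: "y \<noteq> 0"
    and Z: "Z \<in> divisors \<iota>" "\<And>v. v \<in> places \<iota> \<Longrightarrow> coef Z v = max 0 (v y)"
    and E: "E \<in> divisors \<iota>" "\<And>v. v \<in> places \<iota> \<Longrightarrow> coef E v = max 0 (v (inverse y))"
  shows "div_degree \<iota> Z \<le> div_degree \<iota> E"
proof -
  obtain D where D: "D \<in> divisors \<iota>" "\<And>v. v \<in> places \<iota> \<Longrightarrow> coef D v = max 0 (v y)"
    and deg: "div_degree \<iota> D = int (\<Sum>v\<in>{v \<in> places \<iota>. v y > 0}. nat (v y) * place_degree \<iota> v)"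
    using zero_divisor_exists[OF y0] by blast
  have "Z = D"
    using Z D by (intro divisor_eqI) auto
  obtain T where T: "vs.subspace T" "finite T" "free_over y T"
    and "card T = CARD('k) ^ (\<Sum>w\<in>{v \<in> places \<iota>. v y > 0}. nat (w y) * place_degree \<iota> w)"
    using free_subspace_from_zeros[OF finite_zeros[OF y0] _ y0] by blast
  then have "CARD('k) ^ nat (div_degree \<iota> D) \<le> CARD('k) ^ nat (div_degree \<iota> E)"
    using card_free_over_le[OF T E] by (simp only: deg nat_int)
  then have "nat (div_degree \<iota> D) \<le> nat (div_degree \<iota> E)"
    using card_constants_gt_1 by simp
  moreover have "div_degree \<iota> E \<ge> 0" "div_degree \<iota> D \<ge> 0"
    using E D by (auto intro!: div_degree_nonneg)
  ultimately show ?thesis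
    by (simp add: \<open>Z = D\<close>)
qed

lemma principal_divisor_exists:
  assumes "f \<noteq> 0"
  obtains D where "is_divisor_of \<iota> f D"
proof -
  obtain Z where Z: "Z \<in> divisors \<iota>" "\<And>v. v \<in> places \<iota> \<Longrightarrow> coef Z v = max 0 (v f)"
    using zero_divisor_exists[OF assms] by blast
  obtain E where E: "E \<in> divisors \<iota>" "\<And>v. v \<in> places \<iota> \<Longrightarrow> coef E v = max 0 (v (inverse f))"
    using zero_divisor_exists[of "inverse f"] assms by auto
  have "is_divisor_of \<iota> f (Z - E)"
    using Z E assms by (auto simp: is_divisor_of_def lookup_minus place_inverse)
  then show thesis
    by (rule that)
qed

text \<open>Passing from \<open>f\<close> to \<open>inverse f\<close> exchanges zeros and poles, so
  the one inequality gives both.\<close>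

lemma div_degree_principal:
  assumes D: "is_divisor_of \<iota> f D"
  shows "div_degree \<iota> D = 0"
proof -
  have f: "f \<noteq> 0"
    using D by (simp add: is_divisor_of_def)
  obtain Z where Z: "Z \<in> divisors \<iota>" "\<And>v. v \<in> places \<iota> \<Longrightarrow> coef Z v = max 0 (v f)"
    using zero_divisor_exists[OF f] by blast
  obtain E where E: "E \<in> divisors \<iota>" "\<And>v. v \<in> places \<iota> \<Longrightarrow> coef E v = max 0 (v (inverse f))"
    using zero_divisor_exists[of "inverse f"] f by auto
  have "D = Z - E"
    using D Z E by (intro divisor_eqI) (auto simp: is_divisor_of_def lookup_minus place_inverse)
  moreover have "div_degree \<iota> Z \<le> div_degree \<iota> E"
    using degree_zeros_le_degree_poles[OF f Z E] .
  moreover have "div_degree \<iota> E \<le> div_degree \<iota> Z"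
    using degree_zeros_le_degree_poles[of "inverse f", OF _ E, of Z] f Z by simp
  ultimately show ?thesis
    by (simp add: div_degree_diff)
qed

lemma ell_add_principal:
  assumes A: "A \<in> divisors \<iota>" and W: "is_divisor_of \<iota> f W"
  shows "ell \<iota> (A + W) = ell \<iota> A"
proof -
  have W': "W \<in> divisors \<iota>" "f \<noteq> 0"
    using W by (auto simp: is_divisor_of_def)
  have "bij_betw (\<lambda>g. g * f) (LL \<iota> (A + W)) (LL \<iota> A)"
  proof (rule bij_betw_byWitness[of _ "\<lambda>g. g / f"])
    have "is_divisor_of \<iota> f ((A + W) - A)"
      using W by simp
    note mult = LL_mult_principal[OF this]
    show "(\<lambda>g. g * f) ` LL \<iota> (A + W) \<subseteq> LL \<iota> A"
      using mult by auto
    show "(\<lambda>g. g / f) ` LL \<iota> A \<subseteq> LL \<iota> (A + W)"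
      using mult W'(2) by (auto simp flip: mult)
  qed (use W' in auto)
  then have "card (LL \<iota> (A + W)) = card (LL \<iota> A)"
    by (rule bij_betw_same_card)
  then show ?thesis
    using ell_le_iff[of "A + W" A] ell_le_iff[of A "A + W"] A W'(1) by simp
qed

text \<open>Along the divisors \<open>A r\<close> the quantity deg - ell is bounded by direct
  counting, since both terms grow with slope \<open>c\<close>. It is monotone in the divisor and
  unchanged by adding principal divisors, and up to a principal divisor every \<open>D\<close> lies
  below some \<open>A r\<close>.\<close>

lemma riemann_bound:
  obtains \<gamma> where "\<And>D. D \<in> divisors \<iota> \<Longrightarrow> div_degree \<iota> D - int (ell \<iota> D) \<le> \<gamma>"
proof -
  obtain y where y: "y \<notin> range \<iota>"
    using finite_over_rational transcendental_iff by blast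
  then have y0: "y \<noteq> 0"
    by (metis hom_zero rangeI)
  have y': "inverse y \<notin> range \<iota>" "inverse y \<noteq> 0"
    using inverse_notin_constants[OF y] y0 by auto
  obtain E where E: "E \<in> divisors \<iota>" "\<And>v. v \<in> places \<iota> \<Longrightarrow> coef E v = max 0 (v (inverse y))"
    and deg_E: "div_degree \<iota> E = int (\<Sum>v\<in>{v \<in> places \<iota>. v (inverse y) > 0}. nat (v (inverse y)) * place_degree \<iota> v)"
    using zero_divisor_exists[OF y'(2)] by blast
  define c where "c = nat (div_degree \<iota> E)"
  have E0: "div_degree \<iota> E \<ge> 0"
    using E by (auto intro!: div_degree_nonneg)
  have "c > 0"
  proof (rule ccontr)
    assume "\<not> c > 0"
    then have "E = 0"
      using E E0 by (intro div_degree_eq_0) (auto simp: c_def)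
    moreover obtain v where "v \<in> places \<iota>" "v (inverse y) > 0"
      using exists_zero[OF y'(1)] by blast
    ultimately show False
      using E(2)[of v] by simp
  qed
  let ?S = "{v \<in> places \<iota>. v (inverse y) > 0}"
  obtain T where T: "vs.subspace T" "finite T" "free_over (inverse y) T"
    and "card T = CARD('k) ^ (\<Sum>v\<in>?S. nat (v (inverse y)) * place_degree \<iota> v)"
  proof (rule free_subspace_from_zeros[of ?S "inverse y"])
    show "finite ?S"
      by (rule finite_zeros[OF y'(2)])
    show "w (inverse y) > 0" if "w \<in> ?S" for w
      using that by simp
  qed (use y'(2) in blast)+
  from this(4) have card_T: "card T = CARD('k) ^ c"
    unfolding c_def deg_E nat_int .
  \<comment> \<open>The poles of \<open>y\<close> are the zeros of \<open>inverse y\<close>, so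
    \<open>T\<close> is constructed free over \<open>inverse y\<close>; the sums in L(A r) use
    powers of \<open>y\<close>.\<close>
  have free: "free_over y T"
    using free_over_inverse[OF T(3) y'(2)] by simp
  obtain C where C: "C \<in> divisors \<iota>" "T \<subseteq> LL \<iota> C"
    by (rule finite_set_in_LL[OF T(2)])
  define A where "A r = C + div_scale (int r) E" for r :: nat
  have A: "A r \<in> divisors \<iota>" for r
    using C E by (simp add: A_def)
  have ell_A: "ell \<iota> (A r) \<ge> c * Suc r" for r
  proof -
    have "CARD('k) ^ (c * Suc r) = card (psums y T (Suc r))"
      by (simp add: card_psums[OF T(1) free] card_T power_mult del: mult_Suc_right power_Suc)
    also have "\<dots> \<le> card (LL \<iota> (A r))"
      unfolding A_def using psums_subset_LL[OF C(2) E(2)] A[unfolded A_def]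
      by (intro card_mono finite_LL) auto
    also have "\<dots> = CARD('k) ^ ell \<iota> (A r)"
      by (rule card_LL[OF A])
    finally show ?thesis
      using card_constants_gt_1 by (metis power_increasing_iff)
  qed
  have "div_degree \<iota> D - int (ell \<iota> D) \<le> div_degree \<iota> C - int c" if D: "D \<in> divisors \<iota>" for D
  proof -
    obtain D' where D': "D' \<in> divisors \<iota>" "\<And>v. v \<in> places \<iota> \<Longrightarrow> coef D' v = max 0 (coef D v)"
    proof (rule exists_divisor)
      show "finite {v \<in> places \<iota>. max 0 (coef D v) \<noteq> 0}"
        by (rule finite_subset[of _ "Poly_Mapping.keys D"]) (auto simp: in_keys_iff)
    qed blast
    \<comment> \<open>With \<open>r = deg D'\<close>, subtracting \<open>D'\<close> from
      \<open>A r\<close> loses at most \<open>r\<close> dimensions out of at least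
      \<open>c * Suc r\<close>, so a nonzero function survives. This is where \<open>c > 0\<close>
      matters.\<close>
    define r where "r = nat (div_degree \<iota> D')"
    have "div_degree \<iota> D' \<ge> 0"
      using D' by (auto intro!: div_degree_nonneg)
    then have r: "div_degree \<iota> D' = int r"
      by (simp add: r_def)
    have "int (ell \<iota> (A r)) - int (ell \<iota> (A r - D')) \<le> int r"
      using ell_diff_le[of "A r - D'" "A r"] A D' r
      by (simp add: div_degree_diff div_le_def lookup_minus)
    moreover have "c * Suc r \<ge> Suc r"
      using \<open>c > 0\<close> by (cases c) auto
    ultimately have "ell \<iota> (A r - D') > 0"
      using ell_A[of r] by linarith
    then have "card (LL \<iota> (A r - D')) > 1"
      using one_less_power[OF card_constants_gt_1] A D' by (simp only: card_LL divisors_diff)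
    then have "LL \<iota> (A r - D') \<noteq> {0}"
      by auto
    then obtain f where f: "f \<in> LL \<iota> (A r - D')" "f \<noteq> 0"
      using LL_zero by blast
    obtain W where W: "is_divisor_of \<iota> f W"
      using principal_divisor_exists[OF f(2)] .
    then have W': "W \<in> divisors \<iota>" "\<And>v. v \<in> places \<iota> \<Longrightarrow> coef W v = v f"
      by (auto simp: is_divisor_of_def)
    have le: "div_le D (A r + W)"
      unfolding div_le_def
    proof
      fix v assume v: "v \<in> places \<iota>"
      then have "- coef (A r - D') v \<le> v f"
        using f by (auto simp: LL_iff val_ge_def)
      then show "coef D v \<le> coef (A r + W) v"
        using W'(2)[OF v] D'(2)[OF v] by (simp add: lookup_minus lookup_add)
    qed
    have "div_degree \<iota> D - int (ell \<iota> D) \<le> div_degree \<iota> (A r + W) - int (ell \<iota> (A r + W))"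
      using ell_diff_le[OF D _ le] A W'(1) by simp
    also have "\<dots> = div_degree \<iota> C + int r * int c - int (ell \<iota> (A r))"
      using ell_add_principal[OF A W] div_degree_principal[OF W] E0
      by (simp add: div_degree_add A_def div_degree_scale c_def)
    also have "\<dots> \<le> div_degree \<iota> C + int r * int c - int (c * Suc r)"
      using ell_A[of r] by linarith
    also have "\<dots> = div_degree \<iota> C - int c"
      by (simp add: algebra_simps)
    finally show ?thesis .
  qed
  then show thesis
    using that by blast
qed

end

section \<open>Divisor classes and gap counting\<close>

text \<open>The integers are not well-ordered, so \<open>LEAST\<close> in \<open>gamma\<close> needs
  a witness and a lower bound; a shift to the naturals does the rest.\<close>

lemma int_Least_props:
  fixes b :: int
  assumes "Q n" and "\<And>m. Q m \<Longrightarrow> b \<le> m"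
  shows "Q (LEAST m. Q m)" "\<And>m. Q m \<Longrightarrow> (LEAST m. Q m) \<le> m"
proof -
  obtain x where x: "Q x" "\<And>m. Q m \<Longrightarrow> nat (x - b) \<le> nat (m - b)"
    using ex_has_least_nat[of Q n "\<lambda>m. nat (m - b)"] assms(1) by blast
  have le: "x \<le> m" if "Q m" for m
    using x(2)[OF that] assms(2)[OF that] assms(2)[OF x(1)] by linarith
  then have "(LEAST m. Q m) = x"
    using x(1) by (intro Least_equality) auto
  then show "Q (LEAST m. Q m)" "\<And>m. Q m \<Longrightarrow> (LEAST m. Q m) \<le> m"
    using x(1) le by auto
qed

lemma int_Greatest_upper:
  fixes b :: int
  assumes "Q n" and "\<And>m. Q m \<Longrightarrow> m \<le> b"
  shows "n \<le> (GREATEST m. Q m)"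
proof -
  obtain x where x: "Q x" "\<And>m. Q m \<Longrightarrow> nat (b - x) \<le> nat (b - m)"
    using ex_has_least_nat[of Q n "\<lambda>m. nat (b - m)"] assms(1) by blast
  have le: "m \<le> x" if "Q m" for m
    using x(2)[OF that] assms(2)[OF that] assms(2)[OF x(1)] by linarith
  then have "(GREATEST m. Q m) = x"
    using x(1) by (intro Greatest_equality) auto
  then show ?thesis
    using le assms(1) by simp
qed

context function_field
begin

section \<open>Divisor classes and jumps at a place\<close>

lemma is_divisor_of_one: "is_divisor_of \<iota> 1 0"
  by (simp add: is_divisor_of_def place_one)

lemma is_divisor_of_mult:
  "\<lbrakk>is_divisor_of \<iota> f D; is_divisor_of \<iota> g E\<rbrakk> \<Longrightarrow> is_divisor_of \<iota> (f * g) (D + E)"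
  by (auto simp: is_divisor_of_def lookup_add place_mult)

lemma is_divisor_of_inverse: "is_divisor_of \<iota> f D \<Longrightarrow> is_divisor_of \<iota> (inverse f) (- D)"
  by (auto simp: is_divisor_of_def place_inverse)

definition principal :: "'a divisor \<Rightarrow> bool" where
  "principal D \<longleftrightarrow> (\<exists>f. is_divisor_of \<iota> f D)"

lemma principal_zero: "principal 0"
  and principal_add: "\<lbrakk>principal D; principal E\<rbrakk> \<Longrightarrow> principal (D + E)"
  and principal_uminus: "principal D \<Longrightarrow> principal (- D)"
  unfolding principal_def
  using is_divisor_of_one is_divisor_of_mult is_divisor_of_inverse by blast+

lemma lin_equiv_iff:
  "(D, E) \<in> lin_equiv \<iota> \<longleftrightarrow> D \<in> divisors \<iota> \<and> E \<in> divisors \<iota> \<and> principal (D - E)"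
  by (simp add: lin_equiv_def principal_def)

definition cls :: "'a divisor \<Rightarrow> 'a divisor set" where
  "cls D = lin_equiv \<iota> `` {D}"

lemma cls_iff: "D \<in> divisors \<iota> \<Longrightarrow> E \<in> cls D \<longleftrightarrow> E \<in> divisors \<iota> \<and> principal (D - E)"
  by (auto simp: cls_def lin_equiv_iff)

lemma cls_self: "D \<in> divisors \<iota> \<Longrightarrow> D \<in> cls D"
  by (simp add: cls_iff principal_zero)

lemma cls_in_divisor_classes: "D \<in> divisors \<iota> \<Longrightarrow> cls D \<in> divisor_classes \<iota>"
  by (simp add: cls_def divisor_classes_def quotientI)

lemma divisor_classE:
  assumes "A \<in> divisor_classes \<iota>"
  obtains D where "D \<in> divisors \<iota>" "A = cls D"
  using assms unfolding divisor_classes_def cls_def by (auto elim: quotientE)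

lemma class_diff_cls:
  assumes D: "D \<in> divisors \<iota>" and E: "E \<in> divisors \<iota>"
  shows "class_diff (cls D) (cls E) = cls (D - E)"
proof (intro equalityI subsetI)
  fix F assume "F \<in> class_diff (cls D) (cls E)"
  then obtain D' E' where F: "F = D' - E'" "D' \<in> cls D" "E' \<in> cls E"
    by (auto simp: class_diff_def)
  then have "principal ((D - D') + - (E - E'))"
    by (intro principal_add principal_uminus) (auto simp: cls_iff D E)
  moreover have "(D - D') + - (E - E') = (D - E) - F"
    by (simp add: F)
  ultimately have "principal ((D - E) - F)" by metis
  then show "F \<in> cls (D - E)"
    using F D E by (auto simp: cls_iff)
next
  fix F assume "F \<in> cls (D - E)"
  then have F: "F \<in> divisors \<iota>" "principal (D - (F + E))"
    using D E by (auto simp: cls_iff algebra_simps)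
  then have "F + E \<in> cls D" "E \<in> cls E"
    using D E by (auto simp: cls_iff principal_zero)
  then show "F \<in> class_diff (cls D) (cls E)"
    unfolding class_diff_def by (intro CollectI exI[of _ "F + E"] exI[of _ E]) simp
qed

lemma class_neg_cls:
  assumes D: "D \<in> divisors \<iota>"
  shows "class_neg (cls D) = cls (- D)"
proof (intro equalityI subsetI)
  fix F assume "F \<in> class_neg (cls D)"
  then obtain E where E: "F = - E" "E \<in> divisors \<iota>" "principal (D - E)"
    using D by (auto simp: class_neg_def cls_iff)
  then show "F \<in> cls (- D)"
    using D principal_uminus[OF E(3)] by (simp add: cls_iff)
next
  fix F assume "F \<in> cls (- D)"
  then have F: "F \<in> divisors \<iota>" "principal (- D - F)"
    using D by (auto simp: cls_iff)
  have "- F \<in> cls D"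
    using D F(1) principal_uminus[OF F(2)] by (simp add: cls_iff add.commute)
  then show "F \<in> class_neg (cls D)"
    unfolding class_neg_def by (intro image_eqI[of _ _ "- F"]) auto
qed

definition jump :: "('a \<Rightarrow> int) \<Rightarrow> 'a divisor \<Rightarrow> bool" where
  "jump P D \<longleftrightarrow> LL \<iota> D \<noteq> LL \<iota> (D - Poly_Mapping.single P 1)"

text \<open>A jump is witnessed by a function whose order at \<open>P\<close> is the least that L(D)
  allows. In this form products of witnesses show that jumps add.\<close>

lemma jump_iff:
  assumes P: "P \<in> places \<iota>"
  shows "jump P D \<longleftrightarrow> (\<exists>f\<in>LL \<iota> D. f \<noteq> 0 \<and> P f = - coef D P)"
proof -
  have "f \<in> LL \<iota> (D - Poly_Mapping.single P 1) \<longleftrightarrow> f \<in> LL \<iota> D \<and> val_ge P (1 - coef D P) f" for f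
  proof (cases "f \<in> LL \<iota> (D - Poly_Mapping.single P 1)")
    case True
    moreover have "f \<in> LL \<iota> D"
      using True LL_mono[of "D - Poly_Mapping.single P 1" D]
      by (simp add: div_le_def lookup_minus lookup_single when_def subset_iff)
    ultimately show ?thesis
      using P by (auto simp: LL_iff lookup_minus)
  next
    case False
    then obtain v where "v \<in> places \<iota>" "\<not> val_ge v (- coef (D - Poly_Mapping.single P 1) v) f"
      by (auto simp: LL_iff)
    then show ?thesis
      using False by (cases "v = P") (auto simp: LL_iff lookup_minus lookup_single)
  qed
  then have "jump P D \<longleftrightarrow> (\<exists>f\<in>LL \<iota> D. \<not> val_ge P (1 - coef D P) f)"
    unfolding jump_def by blast
  also have "\<dots> \<longleftrightarrow> (\<exists>f\<in>LL \<iota> D. f \<noteq> 0 \<and> P f = - coef D P)"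
    using P by (intro bex_cong refl) (auto simp: LL_iff val_ge_def)
  finally show ?thesis .
qed

lemma jump_zero: "P \<in> places \<iota> \<Longrightarrow> jump P 0"
  by (auto simp: jump_iff LL_iff val_ge_def place_one intro!: bexI[of _ 1])

lemma jump_add:
  assumes P: "P \<in> places \<iota>" and "jump P D" "jump P E"
  shows "jump P (D + E)"
proof -
  obtain f g where "f \<in> LL \<iota> D" "f \<noteq> 0" "P f = - coef D P" "g \<in> LL \<iota> E" "g \<noteq> 0" "P g = - coef E P"
    using assms by (auto simp: jump_iff)
  then show ?thesis
    unfolding jump_iff[OF P]
    by (intro bexI[of _ "f * g"]) (auto simp: place_mult[OF P] lookup_add LL_mult)
qed

lemma jump_principal:
  assumes P: "P \<in> places \<iota>" and "principal D"
  shows "jump P D"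
proof -
  obtain f where f: "is_divisor_of \<iota> (inverse f) (- D)" "is_divisor_of \<iota> f D"
    using assms is_divisor_of_inverse unfolding principal_def by blast
  then have "inverse f \<noteq> 0" "\<And>v. v \<in> places \<iota> \<Longrightarrow> v (inverse f) = - coef D v"
    by (auto simp: is_divisor_of_def)
  then show ?thesis
    unfolding jump_iff[OF P] using P by (intro bexI[of _ "inverse f"]) (auto simp: LL_iff val_ge_def)
qed

text \<open>Principal divisors and their negatives jump, and jumps add, so either side yields the
  other.\<close>

lemma jump_cong:
  assumes P: "P \<in> places \<iota>" and "principal (D - E)"
  shows "jump P D \<longleftrightarrow> jump P E"
  using jump_add[OF P jump_principal[OF P assms(2)], of E]
    jump_add[OF P jump_principal[OF P principal_uminus[OF assms(2)]], of D] by auto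

lemma cls_in_Gamma:
  assumes P: "P \<in> places \<iota>" and D: "D \<in> divisors \<iota>"
  shows "cls D \<in> Gamma \<iota> P \<longleftrightarrow> jump P D"
proof -
  have "cls D \<in> Gamma \<iota> P \<longleftrightarrow> (\<exists>E\<in>cls D. jump P E)"
    by (simp add: Gamma_def cls_in_divisor_classes[OF D] jump_def)
  also have "\<dots> \<longleftrightarrow> jump P D"
    using jump_cong[OF P] cls_self[OF D] by (auto simp: cls_iff[OF D])
  finally show ?thesis .
qed

end

context finite_function_field
begin

section \<open>Degrees of classes, genus and gap counting\<close>

lemma div_degree_le_genus:
  assumes "D \<in> divisors \<iota>"
  shows "div_degree \<iota> D - int (ell \<iota> D) + 1 \<le> genus \<iota>"
proof -
  obtain \<gamma> where "\<And>D. D \<in> divisors \<iota> \<Longrightarrow> div_degree \<iota> D - int (ell \<iota> D) \<le> \<gamma>"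
    using riemann_bound by blast
  then show ?thesis
    unfolding genus_def using assms by (intro int_Greatest_upper[of _ _ "\<gamma> + 1"]) auto
qed

lemma class_degree_cls:
  assumes D: "D \<in> divisors \<iota>"
  shows "class_degree \<iota> (cls D) = div_degree \<iota> D"
  unfolding class_degree_def
proof (rule the_equality)
  show "\<forall>E\<in>cls D. div_degree \<iota> E = div_degree \<iota> D"
    using div_degree_principal by (fastforce simp: cls_iff[OF D] principal_def div_degree_diff)
  show "d = div_degree \<iota> D" if "\<forall>E\<in>cls D. div_degree \<iota> E = d" for d
    using bspec[OF that cls_self[OF D]] by simp
qed

text \<open>Adding the divisor of \<open>f\<close> to \<open>D\<close> gives an effective divisor of
  the same degree; in degree 0 it must be 0, so \<open>D\<close> is the divisor of
  \<open>inverse f\<close>.\<close>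

lemma LL_effective:
  assumes D: "D \<in> divisors \<iota>" and f: "f \<in> LL \<iota> D" "f \<noteq> 0"
  shows "div_degree \<iota> D \<ge> 0" and "div_degree \<iota> D = 0 \<Longrightarrow> principal D"
proof -
  obtain W where W: "is_divisor_of \<iota> f W"
    using principal_divisor_exists[OF f(2)] .
  have W': "W \<in> divisors \<iota>" "\<And>v. v \<in> places \<iota> \<Longrightarrow> coef (D + W) v \<ge> 0"
    using W f by (auto simp: is_divisor_of_def LL_iff val_ge_def lookup_add)
  have deg: "div_degree \<iota> (D + W) = div_degree \<iota> D"
    using div_degree_principal[OF W] by (simp add: div_degree_add)
  show "div_degree \<iota> D \<ge> 0"
    using div_degree_nonneg[OF W'(2)] D W'(1) deg by simp
  assume "div_degree \<iota> D = 0"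
  then have "D + W = 0"
    using div_degree_eq_0[OF W'(2)] D W'(1) deg by simp
  then have "D = - W"
    by (simp add: eq_neg_iff_add_eq_0)
  then show "principal D"
    using is_divisor_of_inverse[OF W] by (auto simp: principal_def)
qed

lemma jump_degree:
  assumes P: "P \<in> places \<iota>" and D: "D \<in> divisors \<iota>" and "jump P D"
  shows "div_degree \<iota> D \<ge> 0" and "div_degree \<iota> D = 0 \<Longrightarrow> principal D"
  using assms(3) LL_effective[OF D] unfolding jump_iff[OF P] by blast+

lemma ell_neg_degree:
  assumes D: "D \<in> divisors \<iota>" and "div_degree \<iota> D < 0"
  shows "ell \<iota> D = 0"
proof -
  have "LL \<iota> D = {0}"
    using LL_effective(1)[OF D] assms(2) LL_zero[of D] by force
  then have "CARD('k) ^ ell \<iota> D = CARD('k) ^ 0"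
    using card_LL[OF D] by simp
  then show ?thesis
    using card_constants_gt_1 power_inject_exp by blast
qed

text \<open>At a place of degree 1 the dimension changes by at most one, so differences of
  \<open>ell\<close> along multiples of \<open>P\<close> count jumps.\<close>

lemma ell_jump:
  assumes P: "rational_place \<iota> P" and D: "D \<in> divisors \<iota>"
  shows "int (ell \<iota> D) = int (ell \<iota> (D - Poly_Mapping.single P 1)) + of_bool (jump P D)"
proof -
  have P': "P \<in> places \<iota>" "place_degree \<iota> P = 1"
    using P by (auto simp: rational_place_def)
  let ?D' = "D - Poly_Mapping.single P 1"
  have D': "?D' \<in> divisors \<iota>" "div_le ?D' D"
    using D P' by (auto simp: div_le_def lookup_minus lookup_single when_def)
  have "ell \<iota> D \<le> ell \<iota> ?D' + 1"
    using ell_step[OF D'(1) P'(1)] P'(2) by simp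
  moreover have "ell \<iota> ?D' \<le> ell \<iota> D"
    using ell_mono D D' by blast
  moreover have "jump P D \<longleftrightarrow> ell \<iota> D \<noteq> ell \<iota> ?D'"
  proof
    assume "jump P D"
    then have "LL \<iota> ?D' \<subset> LL \<iota> D"
      using LL_mono[OF D'(2)] by (auto simp: jump_def)
    then have "card (LL \<iota> ?D') < card (LL \<iota> D)"
      using psubset_card_mono finite_LL[OF D] by blast
    then show "ell \<iota> D \<noteq> ell \<iota> ?D'"
      using card_LL D D'(1) by auto
  qed (auto simp: jump_def ell_def)
  ultimately show ?thesis
    by (cases "jump P D") auto
qed

text \<open>If \<open>L(D) = L(D - P)\<close>, then for no \<open>n \<ge> 1\<close> can both \<open>D - nP\<close> and \<open>nP\<close> jump. Summing over
  \<open>n = 1, \<dots>, N\<close> for large \<open>N\<close> yields \<open>\<ell>(D) \<le> g\<close>, contradicting Riemann's inequality for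
  \<open>deg D \<ge> 2g\<close>.\<close>

lemma jump_if_large_degree:
  assumes P: "rational_place \<iota> P" and D: "D \<in> divisors \<iota>" and deg: "div_degree \<iota> D \<ge> 2 * genus \<iota>"
  shows "jump P D"
proof (rule ccontr)
  assume no: "\<not> jump P D"
  have P': "P \<in> places \<iota>" "place_degree \<iota> P = 1"
    using P by (auto simp: rational_place_def)
  define m where "m n = Poly_Mapping.single P (int n)" for n :: nat
  have m: "m n \<in> divisors \<iota>" "div_degree \<iota> (m n) = int n" for n
    using P' by (auto simp: m_def div_degree_single)
  have m_Suc: "m (Suc n) - Poly_Mapping.single P 1 = m n" for n
    by (simp add: m_def flip: single_diff)
  have m_Suc': "D - m n - Poly_Mapping.single P 1 = D - m (Suc n)" for n
    using m_Suc[of n] by (simp add: algebra_simps)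
  have 1: "(\<Sum>n=1..N. of_bool (jump P (m n))) = int (ell \<iota> (m N)) - 1" for N
  proof (induction N)
    case (Suc N)
    then show ?case
      using ell_jump[OF P m(1), of "Suc N"] m_Suc by simp
  qed (simp add: m_def ell_0)
  have 2: "(\<Sum>n=1..N. of_bool (jump P (D - m n))) = int (ell \<iota> (D - m 1)) - int (ell \<iota> (D - m (Suc N)))" for N
  proof (induction N)
    case (Suc N)
    then show ?case
      using ell_jump[OF P, of "D - m (Suc N)"] D m(1) m_Suc' by simp
  qed simp
  have excl: "of_bool (jump P (m n)) + of_bool (jump P (D - m n)) \<le> (1 :: int)" for n
    using no jump_add[OF P'(1), of "m n" "D - m n"] by (auto simp: of_bool_def)
  \<comment> \<open>Large enough that \<open>D - m (Suc N)\<close> has negative degree, so that the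
    second telescoping sum is all of \<open>ell \<iota> D\<close>.\<close>
  define N where "N = nat (div_degree \<iota> D)"
  have "ell \<iota> (D - m (Suc N)) = 0"
    using D m by (intro ell_neg_degree) (auto simp: div_degree_diff N_def)
  moreover have "ell \<iota> (D - m 1) = ell \<iota> D"
    using ell_jump[OF P D] no by (simp add: m_def)
  moreover have "(\<Sum>n=1..N. of_bool (jump P (m n)) + of_bool (jump P (D - m n))) \<le> (\<Sum>n=1..N. (1 :: int))"
    by (rule sum_mono) (rule excl)
  \<comment> \<open>Riemann's inequality for \<open>m N\<close> turns this into
    \<open>ell \<iota> D \<le> genus \<iota>\<close>, whereas for \<open>D\<close> it gives at least
    \<open>genus \<iota> + 1\<close>.\<close>
  ultimately have "int (ell \<iota> (m N)) - 1 + int (ell \<iota> D) \<le> int N"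
    using 1[of N] 2[of N] by (simp add: sum.distrib)
  moreover have "int N - int (ell \<iota> (m N)) + 1 \<le> genus \<iota>"
    using div_degree_le_genus[OF m(1)[of N]] m(2) by simp
  moreover have "div_degree \<iota> D - int (ell \<iota> D) + 1 \<le> genus \<iota>"
    by (rule div_degree_le_genus[OF D])
  ultimately show False
    using deg by linarith
qed

lemma degrees_Gamma_at:
  assumes P: "P \<in> places \<iota>" and D: "D \<in> divisors \<iota>"
  shows "class_degree \<iota> ` Gamma_at \<iota> P (cls D) =
    {div_degree \<iota> A | A. A \<in> divisors \<iota> \<and> jump P A \<and> jump P (A - D)}"
proof -
  have "Gamma_at \<iota> P (cls D) = cls ` {A \<in> divisors \<iota>. jump P A \<and> jump P (A - D)}"
  proof (intro equalityI subsetI)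
    fix X assume X: "X \<in> Gamma_at \<iota> P (cls D)"
    then have "X \<in> divisor_classes \<iota>"
      by (auto simp: Gamma_at_def Gamma_def)
    then obtain A where A: "A \<in> divisors \<iota>" "X = cls A"
      by (rule divisor_classE)
    then show "X \<in> cls ` {A \<in> divisors \<iota>. jump P A \<and> jump P (A - D)}"
      using X D by (auto simp: Gamma_at_def class_diff_cls cls_in_Gamma[OF P])
  qed (use D in \<open>auto simp: Gamma_at_def class_diff_cls cls_in_Gamma[OF P]\<close>)
  then show ?thesis
    by (auto simp: class_degree_cls image_iff)
qed

text \<open>One direction tests the zero class, which lies in \<open>Gamma\<close>; the other uses
  that \<open>Gamma\<close> is closed under addition.\<close>

lemma Gamma_at_eq_Gamma_iff:
  assumes P: "P \<in> places \<iota>" and D: "D \<in> divisors \<iota>"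
  shows "Gamma_at \<iota> P (cls D) = Gamma \<iota> P \<longleftrightarrow> jump P (- D)"
proof
  assume "Gamma_at \<iota> P (cls D) = Gamma \<iota> P"
  then have "cls 0 \<in> Gamma_at \<iota> P (cls D)"
    using jump_zero[OF P] by (simp add: cls_in_Gamma[OF P])
  then show "jump P (- D)"
    using D by (simp add: Gamma_at_def class_diff_cls cls_in_Gamma[OF P])
next
  assume neg: "jump P (- D)"
  have "class_diff X (cls D) \<in> Gamma \<iota> P" if X: "X \<in> Gamma \<iota> P" for X
  proof -
    have "X \<in> divisor_classes \<iota>"
      using X by (simp add: Gamma_def)
    then obtain A where A: "A \<in> divisors \<iota>" "X = cls A"
      by (rule divisor_classE)
    then show ?thesis
      using X D jump_add[OF P _ neg, of A] by (simp add: class_diff_cls cls_in_Gamma[OF P])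
  qed
  then show "Gamma_at \<iota> P (cls D) = Gamma \<iota> P"
    by (auto simp: Gamma_at_def)
qed

lemma gamma_cls:
  assumes P: "rational_place \<iota> P" and D: "D \<in> divisors \<iota>"
  obtains A where "A \<in> divisors \<iota>" "jump P A" "jump P (A - D)" "gamma \<iota> P (cls D) = div_degree \<iota> A"
    "\<And>B. \<lbrakk>B \<in> divisors \<iota>; jump P B; jump P (B - D)\<rbrakk> \<Longrightarrow> gamma \<iota> P (cls D) \<le> div_degree \<iota> B"
proof -
  have P': "P \<in> places \<iota>" "place_degree \<iota> P = 1"
    using P by (auto simp: rational_place_def)
  define Q where "Q d \<longleftrightarrow> (\<exists>A. d = div_degree \<iota> A \<and> A \<in> divisors \<iota> \<and> jump P A \<and> jump P (A - D))" for d
  have gamma: "gamma \<iota> P (cls D) = (LEAST d. Q d)"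
    unfolding gamma_def degrees_Gamma_at[OF P'(1) D] Q_def by simp
  \<comment> \<open>Chosen so that \<open>A\<close> and \<open>A - D\<close> both have degree at
    least twice the genus and hence both jump.\<close>
  define A where "A = Poly_Mapping.single P (max (2 * genus \<iota>) (2 * genus \<iota> + div_degree \<iota> D))"
  have A: "A \<in> divisors \<iota>" "div_degree \<iota> A = max (2 * genus \<iota>) (2 * genus \<iota> + div_degree \<iota> D)"
    using P' by (auto simp: A_def div_degree_single)
  have "jump P A" "jump P (A - D)"
    using A D by (auto intro!: jump_if_large_degree[OF P] simp: div_degree_diff)
  then have "Q (div_degree \<iota> A)"
    unfolding Q_def using A(1) by blast
  moreover have "0 \<le> d" if "Q d" for d
    using that jump_degree(1)[OF P'(1)] by (auto simp: Q_def)
  ultimately have least: "Q (LEAST d. Q d)" "\<And>d. Q d \<Longrightarrow> (LEAST d. Q d) \<le> d"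
    using int_Least_props[of Q "div_degree \<iota> A" 0] by blast+
  obtain A where "A \<in> divisors \<iota>" "jump P A" "jump P (A - D)" "(LEAST d. Q d) = div_degree \<iota> A"
    using least(1) by (auto simp: Q_def)
  then show thesis
    using that[of A] least(2) by (auto simp: gamma Q_def)
qed

end

theorem proposition4p1:
  fixes \<iota> :: "'k::{field,finite} \<Rightarrow> 'a::field"
    and P :: "'a \<Rightarrow> int"
    and C :: "'a divisor set"
  assumes "function_field \<iota>"
    and "rational_place \<iota> P"
    and "C \<in> divisor_classes \<iota>"
  shows "gamma \<iota> P C \<ge> max 0 (class_degree \<iota> C)
    \<and> (gamma \<iota> P C = 0 \<longleftrightarrow> class_neg C \<in> Gamma \<iota> P)
    \<and> (class_neg C \<in> Gamma \<iota> P \<longleftrightarrow> Gamma_at \<iota> P C = Gamma \<iota> P)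
    \<and> (gamma \<iota> P C = class_degree \<iota> C \<longleftrightarrow> C \<in> Gamma \<iota> P)
    \<and> (C \<in> Gamma \<iota> P \<longleftrightarrow> Gamma_at \<iota> P (class_neg C) = Gamma \<iota> P)
    \<and> (gamma \<iota> P C > max 0 (class_degree \<iota> C)
        \<longleftrightarrow> C \<notin> Gamma \<iota> P \<and> class_neg C \<notin> Gamma \<iota> P)
    \<and> (gamma \<iota> P C > max 0 (class_degree \<iota> C) \<longrightarrow> \<bar>class_degree \<iota> C\<bar> < 2 * genus \<iota>)"
proof -
  interpret function_field \<iota> by fact
  interpret finite_function_field \<iota> by unfold_locales
  have P: "P \<in> places \<iota>"
    using assms(2) by (simp add: rational_place_def)
  obtain D where D: "D \<in> divisors \<iota>" and C: "C = cls D"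
    using assms(3) by (rule divisor_classE)
  define d where "d = div_degree \<iota> D"
  have deg: "class_degree \<iota> C = d"
    using D by (simp add: C d_def class_degree_cls)
  have CG: "C \<in> Gamma \<iota> P \<longleftrightarrow> jump P D" and nCG: "class_neg C \<in> Gamma \<iota> P \<longleftrightarrow> jump P (- D)"
    using D by (simp_all add: C class_neg_cls cls_in_Gamma[OF P])
  obtain A where A: "A \<in> divisors \<iota>" "jump P A" "jump P (A - D)"
    and gamma: "gamma \<iota> P C = div_degree \<iota> A"
    and least: "\<And>B. \<lbrakk>B \<in> divisors \<iota>; jump P B; jump P (B - D)\<rbrakk> \<Longrightarrow> gamma \<iota> P C \<le> div_degree \<iota> B"
    unfolding C using gamma_cls[OF assms(2) D] by blast
  have ge: "gamma \<iota> P C \<ge> 0" "gamma \<iota> P C \<ge> d"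
    using jump_degree(1)[OF P _ A(2)] jump_degree(1)[OF P _ A(3)] A(1) D
    by (auto simp: gamma d_def div_degree_diff)
  \<comment> \<open>If the minimum is 0, then \<open>A\<close> is principal and \<open>A - D\<close>
    represents the class of \<open>- D\<close>. Conversely the zero divisor competes for the
    minimum.\<close>
  have neg: "gamma \<iota> P C = 0 \<longleftrightarrow> jump P (- D)"
  proof
    assume "gamma \<iota> P C = 0"
    then have "principal A"
      using jump_degree(2)[OF P A(1,2)] gamma by simp
    then show "jump P (- D)"
      using jump_cong[OF P, of "A - D" "- D"] A(3) by simp
  next
    assume "jump P (- D)"
    then have "gamma \<iota> P C \<le> 0"
      using least[of 0] jump_zero[OF P] by simp
    then show "gamma \<iota> P C = 0"
      using ge by simp
  qed
  \<comment> \<open>The mirror image: now \<open>A - D\<close> has degree 0 and is principal, and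
    \<open>D\<close> itself competes for the minimum.\<close>
  have pos: "gamma \<iota> P C = d \<longleftrightarrow> jump P D"
  proof
    assume "gamma \<iota> P C = d"
    then have "principal (A - D)"
      using jump_degree(2)[OF P _ A(3)] A(1) D gamma by (simp add: d_def div_degree_diff)
    then show "jump P D"
      using jump_cong[OF P, of A D] A(2) by simp
  next
    assume "jump P D"
    then have "gamma \<iota> P C \<le> d"
      using least[OF D] jump_zero[OF P] by (simp add: d_def)
    then show "gamma \<iota> P C = d"
      using ge by simp
  qed
  have strict: "gamma \<iota> P C > max 0 d \<longleftrightarrow> \<not> jump P D \<and> \<not> jump P (- D)"
    using ge neg pos by linarith
  \<comment> \<open>Otherwise \<open>D\<close> or \<open>- D\<close> would have degree at least
    twice the genus and would jump.\<close>
  have "\<bar>d\<bar> < 2 * genus \<iota>" if "\<not> jump P D" "\<not> jump P (- D)"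
    using that jump_if_large_degree[OF assms(2) D]
      jump_if_large_degree[OF assms(2) divisors_uminus[OF D]]
    by (fastforce simp: d_def div_degree_uminus)
  moreover have "Gamma_at \<iota> P C = Gamma \<iota> P \<longleftrightarrow> jump P (- D)"
    unfolding C by (rule Gamma_at_eq_Gamma_iff[OF P D])
  moreover have "Gamma_at \<iota> P (class_neg C) = Gamma \<iota> P \<longleftrightarrow> jump P D"
    using Gamma_at_eq_Gamma_iff[OF P divisors_uminus[OF D]] by (simp add: C class_neg_cls[OF D])
  ultimately show ?thesis
    unfolding deg CG nCG using ge neg pos strict by auto
qed

end
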